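(* Let $k$ be an algebraically closed field of prime characteristic $p$, let $G$ be a finite group, and let $b$ be a block idempotent of $kG$ whose block algebra $B=kGb$ has a nontrivial defect group $P$. If $G$ is non-$p$-perfect and the Scott module $Sc(G,P)$ is isomorphic to the trivial $kG$-module $k$, then $\mathrm{HH}^1(B)\neq 0$.
   Context: A block idempotent $b$ of $kG$ is a primitive idempotent of the center $Z(kG)$; $B=kGb$ is its block algebra. A finite group $L$ is non-$p$-perfect if $\mathcal{O}^p(L)<L$, where $\mathcal{O}^p(L)$ is the smallest normal subgroup of $L$ with $p$-power index. For a $p$-subgroup $Q$ of $G$, the Scott module $Sc(G,Q)$ is the unique (up to isomorphism) indecomposable $kG$-module with vertex $Q$, with trivial source, and having a submodule isomorphic to the trivial $kG$-module $k$. $\mathrm{HH}^1(B)$ is the first Hochschild cohomology of the $k$-algebra $B$, i.e. $k$-linear derivations modulo inner derivations. *)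

theory Defs
  imports
    "HOL-Computational_Algebra.Primes" "HOL-Computational_Algebra.Polynomial"
    "HOL-Algebra.Module" "HOL-Algebra.AbelCoset" "HOL-Algebra.Left_Coset"
    "HOL-Algebra.Generated_Groups" "HOL-Algebra.Free_Abelian_Groups"
begin

section \<open>Modules over a not necessarily commutative ring\<close>

text \<open>The library locale \<open>module\<close> requires a commutative ring of scalars; the following is the
  same notion (unital left modules) over an arbitrary ring. The library predicate \<open>submodule\<close>
  does not use commutativity and is used as it is.\<close>

locale left_module = R?: ring R + M?: abelian_group M
    for R :: "('a, 'm) ring_scheme" (structure) and M :: "('a, 'b, 'n) module_scheme" (structure) +
  assumes smult_closed:
      "\<lbrakk>a \<in> carrier R; x \<in> carrier M\<rbrakk> \<Longrightarrow> a \<odot>\<^bsub>M\<^esub> x \<in> carrier M"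
    and smult_l_distr:
      "\<lbrakk>a \<in> carrier R; b \<in> carrier R; x \<in> carrier M\<rbrakk> \<Longrightarrow>
        (a \<oplus>\<^bsub>R\<^esub> b) \<odot>\<^bsub>M\<^esub> x = a \<odot>\<^bsub>M\<^esub> x \<oplus>\<^bsub>M\<^esub> b \<odot>\<^bsub>M\<^esub> x"
    and smult_r_distr:
      "\<lbrakk>a \<in> carrier R; x \<in> carrier M; y \<in> carrier M\<rbrakk> \<Longrightarrow>
        a \<odot>\<^bsub>M\<^esub> (x \<oplus>\<^bsub>M\<^esub> y) = a \<odot>\<^bsub>M\<^esub> x \<oplus>\<^bsub>M\<^esub> a \<odot>\<^bsub>M\<^esub> y"
    and smult_assoc:
      "\<lbrakk>a \<in> carrier R; b \<in> carrier R; x \<in> carrier M\<rbrakk> \<Longrightarrow>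
        (a \<otimes>\<^bsub>R\<^esub> b) \<odot>\<^bsub>M\<^esub> x = a \<odot>\<^bsub>M\<^esub> (b \<odot>\<^bsub>M\<^esub> x)"
    and smult_one:
      "x \<in> carrier M \<Longrightarrow> \<one>\<^bsub>R\<^esub> \<odot>\<^bsub>M\<^esub> x = x"

definition fin_gen_module :: "('a, 'm) ring_scheme \<Rightarrow> ('a, 'b, 'n) module_scheme \<Rightarrow> bool" where
  "fin_gen_module R M \<longleftrightarrow> left_module R M \<and>
     (\<exists>X. X \<subseteq> carrier M \<and> finite X \<and> (\<forall>U. submodule U R M \<and> X \<subseteq> U \<longrightarrow> U = carrier M))"

definition module_isomorphic ::
    "('a, 'm) ring_scheme \<Rightarrow> ('a, 'b, 'n) module_scheme \<Rightarrow> ('a, 'c, 'l) module_scheme \<Rightarrow> bool" where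
  "module_isomorphic R M N \<longleftrightarrow>
     (\<exists>f \<in> iso (add_monoid M) (add_monoid N).
        \<forall>a \<in> carrier R. \<forall>x \<in> carrier M. f (a \<odot>\<^bsub>M\<^esub> x) = a \<odot>\<^bsub>N\<^esub> f x)"

definition direct_sum ::
    "('a, 'm) ring_scheme \<Rightarrow> ('a, 'b, 'n) module_scheme \<Rightarrow> 'b set \<Rightarrow> 'b set \<Rightarrow> bool" where
  "direct_sum R M U W \<longleftrightarrow> submodule U R M \<and> submodule W R M \<and>
     U \<inter> W = {\<zero>\<^bsub>M\<^esub>} \<and> U <+>\<^bsub>M\<^esub> W = carrier M"

definition indecomposable ::
    "('a, 'm) ring_scheme \<Rightarrow> ('a, 'b, 'n) module_scheme \<Rightarrow> bool" where
  "indecomposable R M \<longleftrightarrow> left_module R M \<and> carrier M \<noteq> {\<zero>\<^bsub>M\<^esub>} \<and>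
     (\<forall>U W. direct_sum R M U W \<longrightarrow> U = {\<zero>\<^bsub>M\<^esub>} \<or> W = {\<zero>\<^bsub>M\<^esub>})"

definition isomorphic_to_summand ::
    "('a, 'm) ring_scheme \<Rightarrow> ('a, 'b, 'n) module_scheme \<Rightarrow> ('a, 'c, 'l) module_scheme \<Rightarrow> bool" where
  "isomorphic_to_summand R M N \<longleftrightarrow>
     (\<exists>U W. direct_sum R N U W \<and> module_isomorphic R M (N\<lparr>carrier := U\<rparr>))"

definition quotient_module ::
    "('a, 'b, 'n) module_scheme \<Rightarrow> 'b set \<Rightarrow> ('a, 'b set) module" where
  "quotient_module M N =
     \<lparr>carrier = a_rcosets\<^bsub>M\<^esub> N, mult = undefined, one = undefined,
      ring.zero = N, ring.add = (\<lambda>X Y. X <+>\<^bsub>M\<^esub> Y),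
      smult = (\<lambda>a X. N <+>\<^bsub>M\<^esub> ((\<lambda>x. a \<odot>\<^bsub>M\<^esub> x) ` X))\<rparr>"


section \<open>Extension of scalars\<close>

text \<open>For a subring \<open>S\<close> of \<open>R\<close> and a left \<open>S\<close>-module \<open>V\<close>, the left \<open>R\<close>-module \<open>R \<otimes>\<^sub>S V\<close>: the free
  abelian group on \<open>R \<times> V\<close> modulo the subgroup generated by the tensor relations, with \<open>R\<close> acting
  by \<open>a (r \<otimes> v) = (a r) \<otimes> v\<close>. The free abelian group together with its scalar multiplication
  is only an auxiliary record, not itself a module.\<close>

definition free_on_pairs ::
    "('a, 'm) ring_scheme \<Rightarrow> ('a, 'b, 'n) module_scheme \<Rightarrow> ('a, ('a \<times> 'b) \<Rightarrow>\<^sub>0 int) module" where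
  "free_on_pairs R V =
     \<lparr>carrier = carrier (free_Abelian_group (carrier R \<times> carrier V)),
      mult = undefined, one = undefined,
      ring.zero = \<one>\<^bsub>free_Abelian_group (carrier R \<times> carrier V)\<^esub>,
      ring.add = mult (free_Abelian_group (carrier R \<times> carrier V)),
      smult = (\<lambda>a. frag_extend (\<lambda>(r, v). frag_of (a \<otimes>\<^bsub>R\<^esub> r, v)))\<rparr>"

definition tensor_relations ::
    "('a, 'm) ring_scheme \<Rightarrow> ('a, 'l) ring_scheme \<Rightarrow> ('a, 'b, 'n) module_scheme
      \<Rightarrow> (('a \<times> 'b) \<Rightarrow>\<^sub>0 int) set" where
  "tensor_relations R S V =
     {frag_of (r \<oplus>\<^bsub>R\<^esub> r', v) - frag_of (r, v) - frag_of (r', v) | r r' v.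
        r \<in> carrier R \<and> r' \<in> carrier R \<and> v \<in> carrier V} \<union>
     {frag_of (r, v \<oplus>\<^bsub>V\<^esub> v') - frag_of (r, v) - frag_of (r, v') | r v v'.
        r \<in> carrier R \<and> v \<in> carrier V \<and> v' \<in> carrier V} \<union>
     {frag_of (r \<otimes>\<^bsub>R\<^esub> s, v) - frag_of (r, s \<odot>\<^bsub>V\<^esub> v) | r s v.
        r \<in> carrier R \<and> s \<in> carrier S \<and> v \<in> carrier V}"

definition extend_scalars ::
    "('a, 'm) ring_scheme \<Rightarrow> ('a, 'l) ring_scheme \<Rightarrow> ('a, 'b, 'n) module_scheme
      \<Rightarrow> ('a, (('a \<times> 'b) \<Rightarrow>\<^sub>0 int) set) module" where
  "extend_scalars R S V =
     quotient_module (free_on_pairs R V)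
       (generate (free_Abelian_group (carrier R \<times> carrier V)) (tensor_relations R S V))"


section \<open>First Hochschild cohomology\<close>

text \<open>An algebra over a field \<open>'k\<close> is represented by a record of type \<open>('k, 'a) module\<close>: the ring
  fields give the ring structure and \<open>smult\<close> the action of \<open>'k\<close>. Derivations are made extensional
  so that they are determined by their values on the carrier.\<close>

definition derivations :: "('k::field, 'a, 'm) module_scheme \<Rightarrow> ('a \<Rightarrow> 'a) set" where
  "derivations A = {D \<in> carrier A \<rightarrow>\<^sub>E carrier A.
     (\<forall>x \<in> carrier A. \<forall>y \<in> carrier A. D (x \<oplus>\<^bsub>A\<^esub> y) = D x \<oplus>\<^bsub>A\<^esub> D y) \<and>
     (\<forall>c. \<forall>x \<in> carrier A. D (c \<odot>\<^bsub>A\<^esub> x) = c \<odot>\<^bsub>A\<^esub> D x) \<and>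
     (\<forall>x \<in> carrier A. \<forall>y \<in> carrier A.
        D (x \<otimes>\<^bsub>A\<^esub> y) = D x \<otimes>\<^bsub>A\<^esub> y \<oplus>\<^bsub>A\<^esub> x \<otimes>\<^bsub>A\<^esub> D y)}"

definition inner_derivations :: "('k::field, 'a, 'm) module_scheme \<Rightarrow> ('a \<Rightarrow> 'a) set" where
  "inner_derivations A =
     {(\<lambda>x \<in> carrier A. c \<otimes>\<^bsub>A\<^esub> x \<ominus>\<^bsub>A\<^esub> x \<otimes>\<^bsub>A\<^esub> c) | c. c \<in> carrier A}"

definition derivation_space :: "('k::field, 'a, 'm) module_scheme \<Rightarrow> ('k, 'a \<Rightarrow> 'a) module" where
  "derivation_space A =
     \<lparr>carrier = derivations A, mult = undefined, one = undefined,
      ring.zero = (\<lambda>x \<in> carrier A. \<zero>\<^bsub>A\<^esub>),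
      ring.add = (\<lambda>D E. \<lambda>x \<in> carrier A. D x \<oplus>\<^bsub>A\<^esub> E x),
      smult = (\<lambda>c D. \<lambda>x \<in> carrier A. c \<odot>\<^bsub>A\<^esub> D x)\<rparr>"

definition HH1 :: "('k::field, 'a, 'm) module_scheme \<Rightarrow> ('k, ('a \<Rightarrow> 'a) set) module" where
  "HH1 A = quotient_module (derivation_space A) (inner_derivations A)"


section \<open>Group algebras and blocks\<close>

text \<open>The group algebra of a finite group \<open>G\<close> consists of the functions on \<open>carrier G\<close>, extended
  by \<open>0\<close>, with the convolution product. Extending by \<open>0\<close> makes the group algebra of a subgroup \<open>Q\<close>,
  i.e. of \<open>G\<lparr>carrier := Q\<rparr>\<close>, a subset of the group algebra of \<open>G\<close>, with the same operations.\<close>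

definition group_algebra :: "('g, 'z) monoid_scheme \<Rightarrow> ('k::field, 'g \<Rightarrow> 'k) module" where
  "group_algebra G =
     \<lparr>carrier = {a. \<forall>x. x \<notin> carrier G \<longrightarrow> a x = 0},
      mult = (\<lambda>a b x. \<Sum>(y, z) \<in> {(y, z) \<in> carrier G \<times> carrier G. y \<otimes>\<^bsub>G\<^esub> z = x}. a y * b z),
      one = (\<lambda>x. if x = \<one>\<^bsub>G\<^esub> then 1 else 0),
      ring.zero = (\<lambda>x. 0),
      ring.add = (\<lambda>a b x. a x + b x),
      smult = (\<lambda>c a x. c * a x)\<rparr>"

abbreviation subgroup_algebra ::
    "('g, 'z) monoid_scheme \<Rightarrow> 'g set \<Rightarrow> ('k::field, 'g \<Rightarrow> 'k) module" where
  "subgroup_algebra G Q \<equiv> group_algebra (G\<lparr>carrier := Q\<rparr>)"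

definition group_element :: "'g \<Rightarrow> 'g \<Rightarrow> 'k::field" where
  "group_element x = (\<lambda>y. if y = x then 1 else 0)"

definition ring_center :: "('a, 'm) ring_scheme \<Rightarrow> 'a set" where
  "ring_center R = {z \<in> carrier R. \<forall>a \<in> carrier R. z \<otimes>\<^bsub>R\<^esub> a = a \<otimes>\<^bsub>R\<^esub> z}"

definition primitive_idempotent :: "('a, 'm) ring_scheme \<Rightarrow> 'a \<Rightarrow> bool" where
  "primitive_idempotent R e \<longleftrightarrow> e \<in> carrier R \<and> e \<otimes>\<^bsub>R\<^esub> e = e \<and> e \<noteq> \<zero>\<^bsub>R\<^esub> \<and>
     \<not> (\<exists>f \<in> carrier R. \<exists>g \<in> carrier R.
          f \<otimes>\<^bsub>R\<^esub> f = f \<and> g \<otimes>\<^bsub>R\<^esub> g = g \<and> f \<noteq> \<zero>\<^bsub>R\<^esub> \<and> g \<noteq> \<zero>\<^bsub>R\<^esub> \<and>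
          f \<otimes>\<^bsub>R\<^esub> g = \<zero>\<^bsub>R\<^esub> \<and> g \<otimes>\<^bsub>R\<^esub> f = \<zero>\<^bsub>R\<^esub> \<and> e = f \<oplus>\<^bsub>R\<^esub> g)"

definition block_idempotent :: "('g, 'z) monoid_scheme \<Rightarrow> ('g \<Rightarrow> 'k::field) \<Rightarrow> bool" where
  "block_idempotent G b \<longleftrightarrow>
     primitive_idempotent ((group_algebra G)\<lparr>carrier := ring_center (group_algebra G)\<rparr>) b"

definition block_algebra ::
    "('g, 'z) monoid_scheme \<Rightarrow> ('g \<Rightarrow> 'k::field) \<Rightarrow> ('k, 'g \<Rightarrow> 'k) module" where
  "block_algebra G b =
     (group_algebra G)
       \<lparr>carrier := {a \<otimes>\<^bsub>group_algebra G\<^esub> b | a. a \<in> carrier (group_algebra G)}, one := b\<rparr>"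


section \<open>Defect groups\<close>

definition conj_action ::
    "('g, 'z) monoid_scheme \<Rightarrow> 'g \<Rightarrow> ('g \<Rightarrow> 'k::field) \<Rightarrow> 'g \<Rightarrow> 'k" where
  "conj_action G x a =
     group_element x \<otimes>\<^bsub>group_algebra G\<^esub> a \<otimes>\<^bsub>group_algebra G\<^esub> group_element (inv\<^bsub>G\<^esub> x)"

definition fixed_points :: "('g, 'z) monoid_scheme \<Rightarrow> 'g set \<Rightarrow> ('g \<Rightarrow> 'k::field) set" where
  "fixed_points G Q = {a \<in> carrier (group_algebra G). \<forall>x \<in> Q. conj_action G x a = a}"

text \<open>The relative trace from \<open>Q\<close> to \<open>G\<close>; on \<open>Q\<close>-fixed points the summand does not depend on the
  representative chosen in each left coset.\<close>

definition relative_trace ::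
    "('g, 'z) monoid_scheme \<Rightarrow> 'g set \<Rightarrow> ('g \<Rightarrow> 'k::field) \<Rightarrow> 'g \<Rightarrow> 'k" where
  "relative_trace G Q a =
     finsum (group_algebra G) (\<lambda>C. conj_action G (SOME x. x \<in> C) a) (lcosets\<^bsub>G\<^esub> Q)"

text \<open>A defect group of \<open>b\<close> is a minimal subgroup \<open>P\<close> such that \<open>b\<close> is a relative trace of a
  \<open>P\<close>-fixed element. That \<open>P\<close> is a \<open>p\<close>-group is a consequence.\<close>

definition defect_group ::
    "('g, 'z) monoid_scheme \<Rightarrow> ('g \<Rightarrow> 'k::field) \<Rightarrow> 'g set \<Rightarrow> bool" where
  "defect_group G b P \<longleftrightarrow> subgroup P G \<and> b \<in> relative_trace G P ` fixed_points G P \<and>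
     (\<forall>Q. subgroup Q G \<and> Q \<subset> P \<longrightarrow> b \<notin> relative_trace G Q ` fixed_points G Q)"


section \<open>Vertices, trivial source and Scott modules\<close>

text \<open>A module over the group algebra of \<open>G\<close> is also a module over that of a subgroup \<open>Q\<close>, by
  restriction of the scalars and without changing the record.\<close>

definition trivial_module :: "('g, 'z) monoid_scheme \<Rightarrow> ('g \<Rightarrow> 'k::field, 'k) module" where
  "trivial_module G =
     \<lparr>carrier = UNIV, mult = undefined, one = undefined, ring.zero = 0, ring.add = (+),
      smult = (\<lambda>a t. (\<Sum>x \<in> carrier G. a x) * t)\<rparr>"

definition induced_module ::
    "('g, 'z) monoid_scheme \<Rightarrow> 'g set \<Rightarrow> ('g \<Rightarrow> 'k::field, 'b, 'n) module_scheme
      \<Rightarrow> ('g \<Rightarrow> 'k, ((('g \<Rightarrow> 'k) \<times> 'b) \<Rightarrow>\<^sub>0 int) set) module" where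
  "induced_module G Q V = extend_scalars (group_algebra G) (subgroup_algebra G Q) V"

text \<open>\<open>M\<close> is relatively \<open>Q\<close>-projective if it is isomorphic to a direct summand of a module induced
  from a finitely generated module \<open>V\<close> of \<open>Q\<close>. The carrier type \<open>nat \<Rightarrow> 'k\<close> of \<open>V\<close> is no
  restriction: \<open>G\<close> is finite, so \<open>V\<close> has finite dimension over \<open>'k\<close>, and it is isomorphic to
  a module whose carrier is a space of coordinate vectors.\<close>

definition relatively_projective ::
    "('g, 'z) monoid_scheme \<Rightarrow> 'g set \<Rightarrow> ('g \<Rightarrow> 'k::field, 'b, 'n) module_scheme \<Rightarrow> bool" where
  "relatively_projective G Q M \<longleftrightarrow>
     (\<exists>V :: ('g \<Rightarrow> 'k, nat \<Rightarrow> 'k) module. fin_gen_module (subgroup_algebra G Q) V \<and>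
        isomorphic_to_summand (group_algebra G) M (induced_module G Q V))"

definition is_vertex ::
    "('g, 'z) monoid_scheme \<Rightarrow> 'g set \<Rightarrow> ('g \<Rightarrow> 'k::field, 'b, 'n) module_scheme \<Rightarrow> bool" where
  "is_vertex G Q M \<longleftrightarrow> subgroup Q G \<and> relatively_projective G Q M \<and>
     (\<forall>R. subgroup R G \<and> R \<subset> Q \<longrightarrow> \<not> relatively_projective G R M)"

definition is_source ::
    "('g, 'z) monoid_scheme \<Rightarrow> 'g set \<Rightarrow> ('g \<Rightarrow> 'k::field, 'b, 'n) module_scheme
      \<Rightarrow> ('g \<Rightarrow> 'k, 'c, 'l) module_scheme \<Rightarrow> bool" where
  "is_source G Q M V \<longleftrightarrow> is_vertex G Q M \<and>
     fin_gen_module (subgroup_algebra G Q) V \<and> indecomposable (subgroup_algebra G Q) V \<and>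
     isomorphic_to_summand (group_algebra G) M (induced_module G Q V)"

definition is_Scott_module ::
    "('g, 'z) monoid_scheme \<Rightarrow> 'g set \<Rightarrow> ('g \<Rightarrow> 'k::field, 'b, 'n) module_scheme \<Rightarrow> bool" where
  "is_Scott_module G Q M \<longleftrightarrow>
     fin_gen_module (group_algebra G) M \<and> indecomposable (group_algebra G) M \<and>
     is_vertex G Q M \<and> is_source G Q M (trivial_module (G\<lparr>carrier := Q\<rparr>)) \<and>
     (\<exists>U. submodule U (group_algebra G) M \<and>
        module_isomorphic (group_algebra G) (M\<lparr>carrier := U\<rparr>) (trivial_module G))"


section \<open>Non-\<open>p\<close>-perfect groups\<close>

definition p_residual :: "nat \<Rightarrow> ('g, 'z) monoid_scheme \<Rightarrow> 'g set" where
  "p_residual p G = (LEAST N. N \<lhd> G \<and> (\<exists>n. card (rcosets\<^bsub>G\<^esub> N) = p ^ n))"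

definition non_p_perfect :: "nat \<Rightarrow> ('g, 'z) monoid_scheme \<Rightarrow> bool" where
  "non_p_perfect p G \<longleftrightarrow> p_residual p G \<subset> carrier G"

end

theory Submission
  imports Defs
    "HOL-Algebra.Group_Action" "HOL-Algebra.Subrings"
    "HOL-Library.Function_Algebras" "HOL-Number_Theory.Cong"
begin

text \<open>Every homomorphism \<open>f\<close> from \<open>G\<close> to the additive group of \<open>k\<close> gives a derivation of \<open>kG\<close>,
  namely \<open>g \<mapsto> f(g) g\<close>. It kills every central idempotent, so it restricts to the block
  algebra \<open>B\<close>. The theorem says that for a suitable \<open>f\<close> this restriction is not inner. Three facts
  about the hypotheses are combined.

  \<^item> Since \<open>G\<close> is not \<open>p\<close>-perfect, it has a nontrivial quotient \<open>H\<close> that is a \<open>p\<close>-group, and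
    such an \<open>H\<close> has a nonzero homomorphism to the prime field. Indeed \<open>H\<close> acts on the functions \<open>\<Phi>\<close> from \<open>H\<close> to the prime field with \<open>\<Phi> 1 = 0\<close> in
    such a way that the fixed points are exactly the homomorphisms, and counting modulo \<open>p\<close> gives a
    fixed point besides \<open>0\<close> (\<open>exists_nonzero_additive_hom\<close>).

  \<^item> The support of \<open>b\<close> meets the centralizer of its defect group \<open>P\<close>
    (\<open>defect_group_meets_centralizer\<close>). Otherwise \<open>b\<close> would be a sum of orbit sums of elements
    whose centralizers in \<open>P\<close> are proper subgroups. Multiplication with the trace expression of
    \<open>b\<close> writes \<open>b\<close> as a sum of traces from these subgroups. By locality of the center of a block
    (Rosenberg's lemma), one of the traces would be enough, against the minimality of \<open>P\<close>.

  \<^item> If the Scott module is trivial, then the trivial module is a direct summand of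
    \<open>kG \<otimes>\<^bsub>kP\<^esub> k\<close>, and this forces the index of \<open>P\<close> to be nonzero in \<open>k\<close>
    (\<open>index_nonzero_if_Scott_module_trivial\<close>).

  Now let the derivation of \<open>f\<close> be inner on \<open>B\<close>, given by \<open>c\<close>. For \<open>h\<close> in \<open>P\<close> and an element \<open>g\<close> of
  the support of \<open>b\<close> that centralizes \<open>P\<close>, the coefficient at \<open>h g\<close> of the value on \<open>h b\<close> is
  \<open>f(h) b(g)\<close> on one side and \<open>c(g) - c(g) = 0\<close> on the other side, so \<open>f\<close> vanishes on \<open>P\<close>
  (\<open>inner_weight_vanishes\<close>). Then \<open>f\<close> is a function on the left cosets of \<open>P\<close>, and translating
  the sum of its values by \<open>x\<close> adds \<open>f(x)\<close> as many times as the index says. Hence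
  \<open>f(x) = 0\<close> for all \<open>x\<close>, a contradiction.\<close>

section \<open>Additive homomorphisms on groups that are not \<open>p\<close>-perfect\<close>

text \<open>Orbits of a \<open>p\<close>-group have \<open>p\<close>-power size, so all orbits except the fixed points have size divisible by \<open>p\<close>.\<close>
lemma (in group_action) card_fixed_points_cong:
  assumes p: "prime p" and ord: "order G = p ^ n" and E: "finite E"
  shows "card {x \<in> E. \<forall>g \<in> carrier G. \<phi> g x = x} mod p = card E mod p"
proof -
  interpret group G using group_hom by (simp add: group_hom_def)
  let ?fix = "{x \<in> E. \<forall>g \<in> carrier G. \<phi> g x = x}"
  let ?O = "orbits G E \<phi>"
  have one_mem: "\<one> \<in> carrier G" by simp
  have part: "\<Union>?O = E" by (rule orbits_coverture)
  have finO: "finite ?O" using E by (simp add: orbits_def)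
  have finc: "finite C" if "C \<in> ?O" for C
    using that part E by (metis Union_upper finite_subset)
  have cardE: "card E = (\<Sum>C\<in>?O. card C)"
  proof -
    have "card (\<Union>?O) = sum card ?O"
      by (rule card_Union_disjoint)
        (use finc disjoint_union in \<open>auto simp: pairwise_def disjnt_def\<close>)
    then show ?thesis by (simp add: part)
  qed
  have orbit_card: "card C = 1 \<or> p dvd card C" if C: "C \<in> ?O" for C
  proof -
    obtain x where x: "x \<in> E" "C = orbit G \<phi> x" using C by (auto simp: orbits_def)
    have "card C dvd p ^ n"
      using orbit_stabilizer_theorem[OF x(1)] ord x(2) by (metis dvd_triv_left)
    then obtain i where "card C = p ^ i"
      using p by (auto simp: divides_primepow_nat)
    then show ?thesis by (cases i) auto
  qed
  have single: "orbit G \<phi> x = {x}" if "x \<in> ?fix" for x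
  proof -
    have "(\<lambda>g. \<phi> g x) ` carrier G = {x}" using that one_mem by auto
    then show ?thesis by (simp add: orbit_def Setcompr_eq_image)
  qed
  have fixed: "(\<Union>C \<in> {C \<in> ?O. card C = 1}. C) = ?fix"
  proof (intro equalityI subsetI)
    fix x assume "x \<in> (\<Union>C \<in> {C \<in> ?O. card C = 1}. C)"
    then obtain C where C: "C \<in> ?O" "card C = 1" "x \<in> C" by auto
    obtain y where y: "y \<in> E" "C = orbit G \<phi> y" using C by (auto simp: orbits_def)
    have yC: "y \<in> C" using y orbit_refl by simp
    have eq: "C = {x}" using C by (auto simp: card_1_singleton_iff)
    then have "y = x" using yC by simp
    then show "x \<in> ?fix" using y eq by (auto simp: orbit_def)
  next
    fix x assume x: "x \<in> ?fix"
    then have "orbit G \<phi> x \<in> ?O" by (auto simp: orbits_def)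
    then show "x \<in> (\<Union>C \<in> {C \<in> ?O. card C = 1}. C)" using single[OF x] by auto
  qed
  have cardfix: "card ?fix = (\<Sum>C \<in> {C \<in> ?O. card C = 1}. card C)"
  proof -
    have "card (\<Union>{C \<in> ?O. card C = 1}) = sum card {C \<in> ?O. card C = 1}"
      by (rule card_Union_disjoint)
        (use finc disjoint_union in \<open>auto simp: pairwise_def disjnt_def\<close>)
    then show ?thesis using fixed by simp
  qed
  have "card E = (\<Sum>C \<in> {C \<in> ?O. card C = 1}. card C) + (\<Sum>C \<in> ?O - {C \<in> ?O. card C = 1}. card C)"
    unfolding cardE using finO 
    by (subst sum.subset_diff[of "{C \<in> ?O. card C = 1}"]) auto
  moreover have "p dvd (\<Sum>C \<in> ?O - {C \<in> ?O. card C = 1}. card C)"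
    by (rule dvd_sum) (use orbit_card in auto)
  ultimately show ?thesis using cardfix by (auto elim!: dvdE)
qed

text \<open>The group acts by \<open>(g \<Phi>) x = \<Phi> (g\<inverse> x) - \<Phi> (g\<inverse>)\<close> on the functions \<open>\<Phi>\<close> to the prime field that
  vanish at \<open>\<one>\<close>; this is translation on functions modulo constants, with the representative
  normalized at \<open>\<one>\<close>. A fixed point satisfies \<open>\<Phi> (g\<inverse> x) = \<Phi> x + \<Phi> (g\<inverse>)\<close>, so it is a
  homomorphism. The number of functions is a positive power of \<open>p\<close>, so \<open>0\<close> is not the only fixed
  point.\<close>
lemma (in group) exists_nonzero_additive_hom_p_group:
  assumes char: "CHAR('k::field) = p" and p: "prime p"
    and ord: "order G = p ^ n" and n: "n > 0"
  shows "\<exists>f :: 'a \<Rightarrow> 'k. (\<forall>x \<in> carrier G. \<forall>y \<in> carrier G. f (x \<otimes> y) = f x + f y) \<and>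
           (\<exists>x \<in> carrier G. f x \<noteq> 0)"
proof -
  \<comment> \<open>\<open>F\<close> is the prime field; finiteness of the set acted on requires values in it.\<close>
  define F where "F = range (of_int :: int \<Rightarrow> 'k)"
  have p0: "p > 0" using p prime_gt_0_nat by blast
  have F0: "0 \<in> F" unfolding F_def by (metis of_int_0 rangeI)
  have Fdiff: "a - b \<in> F" if "a \<in> F" "b \<in> F" for a b
    using that unfolding F_def by (metis (no_types, lifting) imageE of_int_diff rangeI)
  have Feq: "F = of_nat ` {..<p}"
  proof (intro equalityI subsetI)
    fix a assume "a \<in> F"
    then obtain i where i: "a = of_int i" by (auto simp: F_def)
    have "of_int i = (of_int (i mod int p) :: 'k)"
    proof -
      have "of_int i = (of_int (int p * (i div int p) + i mod int p) :: 'k)" by simp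
      also have "\<dots> = of_nat p * of_int (i div int p) + of_int (i mod int p)"
        by (simp only: of_int_add of_int_mult of_int_of_nat_eq)
      finally show ?thesis using char of_nat_CHAR[where ?'a = 'k] by simp
    qed
    also have "\<dots> = of_nat (nat (i mod int p))" using p0 by simp
    finally have "a = of_nat (nat (i mod int p))" using i by simp
    moreover have "nat (i mod int p) \<in> {..<p}" using p0 by (simp add: nat_less_iff)
    ultimately show "a \<in> of_nat ` {..<p}" by blast
  next
    fix a :: 'k assume "a \<in> of_nat ` {..<p}"
    then obtain m where "a = of_nat m" by auto
    then show "a \<in> F" unfolding F_def by (metis of_int_of_nat_eq rangeI)
  qed
  have cardF: "card F = p"
  proof -
    have "inj_on (of_nat :: nat \<Rightarrow> 'k) {..<p}"
      by (rule inj_onI) (auto simp: of_nat_eq_iff_cong_CHAR char cong_def)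
    then show ?thesis unfolding Feq by (simp add: card_image)
  qed
  have finF: "finite F" unfolding Feq by simp
  have finG: "finite (carrier G)"
    using ord p0 by (metis card.infinite order_def power_not_zero not_gr_zero)
  define X where "X = PiE (carrier G) (\<lambda>h. if h = \<one> then {0} else F)"
  define act where "act = (\<lambda>g. \<lambda>\<Phi> \<in> X. \<lambda>x \<in> carrier G. \<Phi> (inv g \<otimes> x) - \<Phi> (inv g) :: 'k)"
  have XF: "\<Phi> x \<in> F" if "\<Phi> \<in> X" "x \<in> carrier G" for \<Phi> x
    using PiE_mem[OF that[unfolded X_def]] F0 by (cases "x = \<one>") auto
  have X1: "\<Phi> \<one> = 0" if "\<Phi> \<in> X" for \<Phi>
    using PiE_mem[OF that[unfolded X_def], of \<one>] by simp
  have Xext: "\<Phi> x = undefined" if "\<Phi> \<in> X" "x \<notin> carrier G" for \<Phi> x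
    using that PiE_arb unfolding X_def by metis
  have act_app: "act g \<Phi> x = \<Phi> (inv g \<otimes> x) - \<Phi> (inv g)" if "\<Phi> \<in> X" "x \<in> carrier G" for g \<Phi> x
    using that by (simp add: act_def)
  have act_ext: "act g \<Phi> x = undefined" if "\<Phi> \<in> X" "x \<notin> carrier G" for g \<Phi> x
    using that by (simp add: act_def)
  have act_closed: "act g \<Phi> \<in> X" if "g \<in> carrier G" "\<Phi> \<in> X" for g \<Phi>
  proof -
    have "act g \<Phi> x \<in> (if x = \<one> then {0} else F)" if "x \<in> carrier G" for x
      using that \<open>g \<in> carrier G\<close> \<open>\<Phi> \<in> X\<close> by (simp add: act_app XF Fdiff)
    then show ?thesis unfolding X_def using act_ext[OF that(2)] by (intro PiE_I) auto
  qed
  have act_comp: "act (g \<otimes> h) \<Phi> = act g (act h \<Phi>)"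
    if "g \<in> carrier G" "h \<in> carrier G" "\<Phi> \<in> X" for g h \<Phi>
  proof
    fix x
    show "act (g \<otimes> h) \<Phi> x = act g (act h \<Phi>) x"
      by (cases "x \<in> carrier G") 
         (use that in \<open>simp_all add: act_app act_ext act_closed inv_mult_group m_assoc\<close>)
  qed
  have act_one: "act \<one> \<Phi> = \<Phi>" if "\<Phi> \<in> X" for \<Phi>
  proof
    fix x
    show "act \<one> \<Phi> x = \<Phi> x"
      by (cases "x \<in> carrier G") (use that in \<open>simp_all add: act_app act_ext X1 Xext\<close>)
  qed
  have act_bij: "act g \<in> Bij X" if g: "g \<in> carrier G" for g
  proof -
    have "bij_betw (act g) X X"
    proof (rule bij_betw_byWitness[where f' = "act (inv g)"])
      show "\<forall>\<Phi>\<in>X. act (inv g) (act g \<Phi>) = \<Phi>"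
        using g act_comp[of "inv g" g] by (simp add: act_one)
      show "\<forall>\<Phi>\<in>X. act g (act (inv g) \<Phi>) = \<Phi>"
        using g act_comp[of g "inv g"] by (simp add: act_one)
    qed (use g act_closed in auto)
    then show ?thesis by (auto simp: Bij_def act_def)
  qed
  have "act \<in> hom G (BijGroup X)"
  proof (rule homI)
    fix g h assume gh: "g \<in> carrier G" "h \<in> carrier G"
    have "act (g \<otimes> h) = compose X (act g) (act h)"
    proof
      fix \<Phi>
      show "act (g \<otimes> h) \<Phi> = compose X (act g) (act h) \<Phi>"
        by (cases "\<Phi> \<in> X") (use gh act_comp in \<open>auto simp: compose_def act_def\<close>)
    qed
    then show "act (g \<otimes> h) = act g \<otimes>\<^bsub>BijGroup X\<^esub> act h"
      using act_bij gh by (simp add: BijGroup_def)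
  qed (use act_bij in \<open>simp add: BijGroup_def\<close>)
  then interpret group_action G X act
    by (intro group_action.intro group_hom.intro group_hom_axioms.intro group_BijGroup is_group)
  have finX: "finite X" unfolding X_def by (rule finite_PiE) (use finG finF in auto)
  have "p dvd card X"
  proof -
    have "1 < order G" unfolding ord using prime_gt_1_nat[OF p] n by (rule one_less_power)
    then have "carrier G \<noteq> {\<one>}" by (auto simp: order_def)
    then have "\<exists>x \<in> carrier G. x \<noteq> \<one>" using one_closed by blast
    then obtain x where x: "x \<in> carrier G" "x \<noteq> \<one>" by blast
    have "card X = (\<Prod>h\<in>carrier G. card (if h = \<one> then {0} else F))"
      unfolding X_def using finG by (simp add: card_PiE)
    then show ?thesis 
      using dvd_prodI[OF finG x(1), of "\<lambda>h. card (if h = \<one> then {0} else F)"] x(2) cardF by simp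
  qed
  then have dvd: "p dvd card {\<Phi> \<in> X. \<forall>g \<in> carrier G. act g \<Phi> = \<Phi>}"
    using card_fixed_points_cong[OF p ord finX] by (simp add: dvd_eq_mod_eq_0)
  let ?zero = "\<lambda>x \<in> carrier G. 0 :: 'k"
  have zeroX: "?zero \<in> X" unfolding X_def using F0 by auto
  have zero_fixed: "?zero \<in> {\<Phi> \<in> X. \<forall>g \<in> carrier G. act g \<Phi> = \<Phi>}"
    using zeroX by (auto simp: act_app act_def fun_eq_iff)
  have "\<exists>\<Phi> \<in> {\<Phi> \<in> X. \<forall>g \<in> carrier G. act g \<Phi> = \<Phi>}. \<Phi> \<noteq> ?zero"
  proof (rule ccontr)
    assume "\<not> ?thesis"
    then have "{\<Phi> \<in> X. \<forall>g \<in> carrier G. act g \<Phi> = \<Phi>} = {?zero}" using zero_fixed by blast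
    
    then have "p dvd 1" using dvd by (simp only:) simp
    then show False using p by (simp add: prime_nat_iff)
  qed
  then obtain \<Phi> where \<Phi>: "\<Phi> \<in> X" "\<And>g. g \<in> carrier G \<Longrightarrow> act g \<Phi> = \<Phi>" "\<Phi> \<noteq> ?zero" by auto
  have "\<Phi> (x \<otimes> y) = \<Phi> x + \<Phi> y" if "x \<in> carrier G" "y \<in> carrier G" for x y
  proof -
    have "\<Phi> (inv (inv x) \<otimes> y) - \<Phi> (inv (inv x)) = \<Phi> y"
      using act_app[OF \<Phi>(1) that(2), of "inv x"] \<Phi>(2)[of "inv x"] that by simp
    then show ?thesis using that by (simp add: diff_eq_eq add.commute)
  qed
  moreover have "\<exists>x \<in> carrier G. \<Phi> x \<noteq> 0"
    using \<Phi>(3) Xext[OF \<Phi>(1)] by (auto simp: fun_eq_iff restrict_def split: if_splits)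
  ultimately show ?thesis by blast
qed

text \<open>If \<open>carrier G\<close> were the only normal subgroup of \<open>p\<close>-power index, the \<open>p\<close>-residual would be
  \<open>carrier G\<close>. So there is a proper one, and a homomorphism on the quotient by it can be inflated.\<close>
lemma (in group) exists_nonzero_additive_hom:
  assumes fin: "finite (carrier G)" and char: "CHAR('k::field) = p" and p: "prime p"
    and np: "non_p_perfect p G"
  shows "\<exists>f :: 'a \<Rightarrow> 'k. (\<forall>x \<in> carrier G. \<forall>y \<in> carrier G. f (x \<otimes> y) = f x + f y) \<and>
           (\<exists>x \<in> carrier G. f x \<noteq> 0)"
proof -
  have self: "carrier G \<lhd> G" by (rule subgroup_self[THEN normal_invI]) auto
  have self_index: "\<exists>n. card (rcosets (carrier G)) = p ^ n"
  proof -
    have "card (rcosets (carrier G)) * order G = order G"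
      using lagrange[OF subgroup_self] subgroup_self
      by (simp add: order_def)
    then have "card (rcosets (carrier G)) = p ^ 0" using fin order_gt_0_iff_finite by auto
    then show ?thesis by blast
  qed
  have "\<exists>N. N \<lhd> G \<and> (\<exists>n. card (rcosets N) = p ^ n) \<and> N \<noteq> carrier G"
  proof (rule ccontr)
    assume *: "\<not> ?thesis"
    have "p_residual p G = carrier G"
      unfolding p_residual_def
      by (rule Least_equality) (use * self self_index in auto)
    then show False using np by (simp add: non_p_perfect_def)
  qed
  then obtain N n where N: "N \<lhd> G" "card (rcosets N) = p ^ n" "N \<noteq> carrier G" by blast
  interpret N: normal N G by (fact N(1))
  interpret Q: group "G Mod N" by (rule N.factorgroup_is_group)
  have ord: "order (G Mod N) = p ^ n" using N(2) by (simp add: order_def FactGroup_def)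
  have "n > 0"
  proof (rule ccontr)
    assume "\<not> n > 0"
    then have "card (rcosets N) = 1" using N(2) by simp
    then have "card N = order G"
      using lagrange[OF N.subgroup_axioms] by simp
    then show False using N(3) N.subset fin by (metis card_subset_eq order_def)
  qed
  from Q.exists_nonzero_additive_hom_p_group[OF char p ord this]
  obtain f :: "'a set \<Rightarrow> 'k"
    where f: "\<And>C D. \<lbrakk>C \<in> carrier (G Mod N); D \<in> carrier (G Mod N)\<rbrakk> \<Longrightarrow> f (C \<otimes>\<^bsub>G Mod N\<^esub> D) = f C + f D"
      and nz: "\<exists>C \<in> carrier (G Mod N). f C \<noteq> 0" by blast
  have mem: "N #> x \<in> carrier (G Mod N)" if "x \<in> carrier G" for x
    using that by (auto simp: FactGroup_def RCOSETS_def)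
  have "f (N #> (x \<otimes> y)) = f (N #> x) + f (N #> y)" if "x \<in> carrier G" "y \<in> carrier G" for x y
    using f[OF mem mem] that N.rcos_sum by (simp add: FactGroup_def)
  moreover have "\<exists>x \<in> carrier G. f (N #> x) \<noteq> 0"
    using nz by (auto simp: FactGroup_def RCOSETS_def)
  ultimately show ?thesis by (intro exI[of _ "\<lambda>x. f (N #> x)"]) auto
qed

section \<open>The group algebra in coordinates\<close>

text \<open>The parameter \<open>field_type\<close> only fixes the field, so that the group algebra is a single record and
  can be made an instance of the ring locales.\<close>
locale finite_group_algebra = group G for G :: "('g, 'z) monoid_scheme" (structure) +
  fixes field_type :: "'k::field itself"
  assumes finite_carrier [simp, intro]: "finite (carrier G)"
begin

abbreviation kG :: "('k, 'g \<Rightarrow> 'k) module" where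
  "kG \<equiv> group_algebra G"

lemma kG_carrier_iff: "a \<in> carrier kG \<longleftrightarrow> (\<forall>x. x \<notin> carrier G \<longrightarrow> a x = 0)"
  by (simp add: group_algebra_def)

lemma kG_outside: "\<lbrakk>a \<in> carrier kG; x \<notin> carrier G\<rbrakk> \<Longrightarrow> a x = 0"
  by (simp add: kG_carrier_iff)

lemma kG_zero: "\<zero>\<^bsub>kG\<^esub> = (\<lambda>x. 0)"
  and kG_one: "\<one>\<^bsub>kG\<^esub> = (\<lambda>x. if x = \<one> then 1 else 0)"
  and kG_add: "a \<oplus>\<^bsub>kG\<^esub> b = (\<lambda>x. a x + b x)"
  and kG_smult: "c \<odot>\<^bsub>kG\<^esub> a = (\<lambda>x. c * a x)"
  by (simp_all add: group_algebra_def)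

lemma kG_mult:
  "a \<otimes>\<^bsub>kG\<^esub> b = (\<lambda>x. if x \<in> carrier G then \<Sum>y\<in>carrier G. a y * b (inv y \<otimes> x) else 0)"
proof
  fix x
  show "(a \<otimes>\<^bsub>kG\<^esub> b) x = (if x \<in> carrier G then \<Sum>y\<in>carrier G. a y * b (inv y \<otimes> x) else 0)"
  proof (cases "x \<in> carrier G")
    case True
    have "(\<Sum>(y, z) \<in> {(y, z) \<in> carrier G \<times> carrier G. y \<otimes> z = x}. a y * b z) =
          (\<Sum>y\<in>carrier G. a y * b (inv y \<otimes> x))"
      by (rule sum.reindex_bij_witness[where i = "\<lambda>y. (y, inv y \<otimes> x)" and j = fst])
         (use True in \<open>auto simp: m_assoc[symmetric]\<close>)
    with True show ?thesis by (simp add: group_algebra_def)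
  next
    case False
    then have "{(y, z) \<in> carrier G \<times> carrier G. y \<otimes> z = x} = {}" by auto
    then have "(\<Sum>(y, z) \<in> {(y, z) \<in> carrier G \<times> carrier G. y \<otimes> z = x}. a y * b z) = 0"
      by (simp only: sum.empty)
    with False show ?thesis by (simp add: group_algebra_def)
  qed
qed

lemma kG_mult_right:
  assumes "x \<in> carrier G"
  shows "(a \<otimes>\<^bsub>kG\<^esub> b) x = (\<Sum>z\<in>carrier G. a (x \<otimes> inv z) * b z)"
proof -
  have "(\<Sum>y\<in>carrier G. a y * b (inv y \<otimes> x)) = (\<Sum>z\<in>carrier G. a (x \<otimes> inv z) * b z)"
    by (rule sum.reindex_bij_witness[where i = "\<lambda>z. x \<otimes> inv z" and j = "\<lambda>y. inv y \<otimes> x"])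
       (use assms in \<open>auto simp: inv_mult_group m_assoc[symmetric]\<close>, 
        (simp add: m_assoc)+)
  then show ?thesis using assms by (simp add: kG_mult)
qed

lemma kG_mult_closed: "a \<otimes>\<^bsub>kG\<^esub> b \<in> carrier kG"
  by (simp add: kG_carrier_iff kG_mult)

lemma kG_mult_assoc:
  "(a \<otimes>\<^bsub>kG\<^esub> b) \<otimes>\<^bsub>kG\<^esub> c = a \<otimes>\<^bsub>kG\<^esub> (b \<otimes>\<^bsub>kG\<^esub> c)"
proof
  fix x
  show "(a \<otimes>\<^bsub>kG\<^esub> b \<otimes>\<^bsub>kG\<^esub> c) x = (a \<otimes>\<^bsub>kG\<^esub> (b \<otimes>\<^bsub>kG\<^esub> c)) x"
  proof (cases "x \<in> carrier G")
    case True
    have "(a \<otimes>\<^bsub>kG\<^esub> b \<otimes>\<^bsub>kG\<^esub> c) x =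
          (\<Sum>z\<in>carrier G. (\<Sum>y\<in>carrier G. a y * b (inv y \<otimes> (x \<otimes> inv z))) * c z)"
      unfolding kG_mult_right[OF True, of "a \<otimes>\<^bsub>kG\<^esub> b"] using True by (simp add: kG_mult)
    also have "\<dots> = (\<Sum>y\<in>carrier G. \<Sum>z\<in>carrier G. a y * (b (inv y \<otimes> (x \<otimes> inv z)) * c z))"
      by (subst sum.swap) (simp add: sum_distrib_right mult.assoc)
    also have "\<dots> = (\<Sum>y\<in>carrier G. a y * (b \<otimes>\<^bsub>kG\<^esub> c) (inv y \<otimes> x))"
      using True by (intro sum.cong refl) (simp add: kG_mult_right sum_distrib_left m_assoc)
    also have "\<dots> = (a \<otimes>\<^bsub>kG\<^esub> (b \<otimes>\<^bsub>kG\<^esub> c)) x"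
      using True by (simp add: kG_mult[of a])
    finally show ?thesis .
  qed (simp add: kG_mult)
qed

lemma group_element_mult:
  assumes "x \<in> carrier G"
  shows "group_element x \<otimes>\<^bsub>kG\<^esub> a = (\<lambda>y. if y \<in> carrier G then a (inv x \<otimes> y) else 0)"
  using assms by (simp add: kG_mult group_element_def if_distrib[of "\<lambda>u. u * _"] cong: if_cong)

lemma mult_group_element:
  assumes "x \<in> carrier G"
  shows "a \<otimes>\<^bsub>kG\<^esub> group_element x = (\<lambda>y. if y \<in> carrier G then a (y \<otimes> inv x) else 0)"
proof
  fix y
  show "(a \<otimes>\<^bsub>kG\<^esub> group_element x) y = (if y \<in> carrier G then a (y \<otimes> inv x) else 0)"
  proof (cases "y \<in> carrier G")
    case True
    then show ?thesis
      using assms by (simp add: kG_mult_right group_element_def if_distrib[of "\<lambda>u. _ * u"] cong: if_cong)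
  qed (simp add: kG_mult)
qed

lemma group_element_closed: "x \<in> carrier G \<Longrightarrow> group_element x \<in> carrier kG"
  by (auto simp: kG_carrier_iff group_element_def)

lemma kG_one_eq: "\<one>\<^bsub>kG\<^esub> = group_element \<one>"
  by (simp add: kG_one group_element_def)

sublocale kG: ring kG
proof (rule ringI)
  show "abelian_group kG"
  proof (rule abelian_groupI)
    fix a assume "a \<in> carrier kG"
    then show "\<exists>b\<in>carrier kG. b \<oplus>\<^bsub>kG\<^esub> a = \<zero>\<^bsub>kG\<^esub>"
      by (intro bexI[of _ "\<lambda>x. - a x"]) (auto simp: kG_add kG_zero kG_carrier_iff)
  qed (auto simp: kG_add kG_zero kG_carrier_iff)
  show "Group.monoid kG"
  proof (rule monoidI)
    fix a assume a: "a \<in> carrier kG"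
    show "\<one>\<^bsub>kG\<^esub> \<otimes>\<^bsub>kG\<^esub> a = a" "a \<otimes>\<^bsub>kG\<^esub> \<one>\<^bsub>kG\<^esub> = a"
      using kG_outside[OF a] by (auto simp: kG_one_eq group_element_mult mult_group_element)
  qed (auto simp: kG_mult_closed kG_mult_assoc kG_one_eq group_element_closed)
qed (auto simp: kG_mult kG_add distrib_left distrib_right sum.distrib)

lemma kG_uminus: "a \<in> carrier kG \<Longrightarrow> \<ominus>\<^bsub>kG\<^esub> a = (\<lambda>x. - a x)"
  by (rule kG.minus_equality) (auto simp: kG_add kG_zero kG_carrier_iff)

lemma kG_finsum:
  "\<lbrakk>finite I; f \<in> I \<rightarrow> carrier kG\<rbrakk> \<Longrightarrow> finsum kG f I = (\<lambda>x. \<Sum>i\<in>I. f i x)"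
  by (induction I rule: finite_induct) (auto simp: kG_zero kG_add)

lemma conj_action_eq:
  assumes "x \<in> carrier G"
  shows "conj_action G x (a :: 'g \<Rightarrow> 'k) = (\<lambda>y. if y \<in> carrier G then a (inv x \<otimes> y \<otimes> x) else 0)"
  using assms by (auto simp: conj_action_def mult_group_element group_element_mult m_assoc)

lemma conj_action_closed: "x \<in> carrier G \<Longrightarrow> conj_action G x (a :: 'g \<Rightarrow> 'k) \<in> carrier kG"
  by (simp add: conj_action_eq kG_carrier_iff)

lemma fixed_points_iff:
  assumes "Q \<subseteq> carrier G"
  shows "a \<in> fixed_points G Q \<longleftrightarrow>
    a \<in> carrier kG \<and> (\<forall>x\<in>Q. \<forall>y\<in>carrier G. a (inv x \<otimes> y \<otimes> x) = a y)"
proof (cases "a \<in> carrier kG")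
  case True
  have "conj_action G x a = a \<longleftrightarrow> (\<forall>y\<in>carrier G. a (inv x \<otimes> y \<otimes> x) = a y)" if "x \<in> Q" for x
    using that assms kG_outside[OF True] by (auto simp: conj_action_eq fun_eq_iff subset_iff)
  then show ?thesis using True by (auto simp: fixed_points_def)
qed (simp add: fixed_points_def)

text \<open>An element is central if and only if it commutes with the group elements, i.e. if its coefficients are constant on conjugacy classes.\<close>
lemma ring_center_iff:
  "z \<in> ring_center kG \<longleftrightarrow>
    z \<in> carrier kG \<and> (\<forall>x\<in>carrier G. \<forall>y\<in>carrier G. z (inv x \<otimes> y \<otimes> x) = z y)"
proof (intro iffI conjI ballI)
  assume z: "z \<in> ring_center kG"
  then show zc: "z \<in> carrier kG" by (simp add: ring_center_def)
  fix x y assume xy: "x \<in> carrier G" "y \<in> carrier G"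
  have "(z \<otimes>\<^bsub>kG\<^esub> group_element x) (y \<otimes> x) = (group_element x \<otimes>\<^bsub>kG\<^esub> z) (y \<otimes> x)"
    using z group_element_closed[OF xy(1)] by (simp add: ring_center_def)
  then show "z (inv x \<otimes> y \<otimes> x) = z y"
    using xy by (simp add: mult_group_element group_element_mult m_assoc)
next
  assume z: "z \<in> carrier kG \<and> (\<forall>x\<in>carrier G. \<forall>y\<in>carrier G. z (inv x \<otimes> y \<otimes> x) = z y)"
  have "z \<otimes>\<^bsub>kG\<^esub> a = a \<otimes>\<^bsub>kG\<^esub> z" for a
  proof
    fix x
    show "(z \<otimes>\<^bsub>kG\<^esub> a) x = (a \<otimes>\<^bsub>kG\<^esub> z) x"
    proof (cases "x \<in> carrier G")
      case True
      have "z (x \<otimes> inv y) = z (inv y \<otimes> x)" if "y \<in> carrier G" for y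
        using bspec[OF bspec[OF conjunct2[OF z] that], of "x \<otimes> inv y"] True that
        by (simp add: m_assoc)
      then show ?thesis
        using True by (simp add: kG_mult_right[of x z a] kG_mult[of a z] mult.commute cong: sum.cong)
    qed (simp add: kG_mult)
  qed
  then show "z \<in> ring_center kG" using z by (simp add: ring_center_def)
qed

text \<open>The choice of representatives made in the definition of \<open>relative_trace\<close>.\<close>
definition coset_rep :: "'g set \<Rightarrow> 'g" where "coset_rep C = (SOME x. x \<in> C)"

lemma coset_rep:
  assumes "subgroup Q G" "C \<in> lcosets Q"
  shows "coset_rep C \<in> carrier G" "coset_rep C <# Q = C"
proof -
  obtain x where x: "x \<in> carrier G" "C = x <# Q" using assms by (auto simp: LCOSETS_def)
  have "coset_rep C \<in> C"
    unfolding coset_rep_def using lcos_self[OF x(1) assms(1)] x(2) by (auto intro: someI)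
  then show "coset_rep C \<in> carrier G" "coset_rep C <# Q = C"
    using x assms(1) l_coset_carrier l_repr_independence subgroup.subset by (metis, metis)
qed

lemma lcosets_subset: "subgroup Q G \<Longrightarrow> C \<in> lcosets Q \<Longrightarrow> C \<subseteq> carrier G"
  using lcosets_part_G by blast

lemma finite_lcosets: "finite (lcosets Q)"
  by (simp add: LCOSETS_def)

lemma lcosetsI: "x \<in> carrier G \<Longrightarrow> x <# Q \<in> lcosets Q"
  by (auto simp: LCOSETS_def)

lemma lcos_eq_iff:
  assumes "subgroup Q G" "x \<in> carrier G" "y \<in> carrier G"
  shows "x <# Q = y <# Q \<longleftrightarrow> inv x \<otimes> y \<in> Q"
proof
  assume "x <# Q = y <# Q"
  then have "y \<in> x <# Q" using lcos_self[OF assms(3,1)] by simp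
  then show "inv x \<otimes> y \<in> Q" using subgroup.lcos_module_imp[OF assms(1)] assms group_axioms by blast
next
  assume h: "inv x \<otimes> y \<in> Q"
  have "y = x \<otimes> (inv x \<otimes> y)" using assms by (simp add: m_assoc[symmetric])
  then have "y \<in> x <# Q" using h by (auto simp: l_coset_def)
  then show "x <# Q = y <# Q" using l_repr_independence assms by blast
qed

lemma relative_trace_eq:
  assumes "subgroup Q G"
  shows "relative_trace G Q (a :: 'g \<Rightarrow> 'k) =
    (\<lambda>y. if y \<in> carrier G
         then \<Sum>C\<in>lcosets Q. a (inv (coset_rep C) \<otimes> y \<otimes> coset_rep C) else 0)"
proof -
  have "finsum kG (\<lambda>C. conj_action G (coset_rep C) a) (lcosets Q) =
        (\<lambda>y. \<Sum>C\<in>lcosets Q. conj_action G (coset_rep C) a y)"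
    by (rule kG_finsum) (auto intro: finite_lcosets conj_action_closed coset_rep[OF assms])
  also have "\<dots> = (\<lambda>y. if y \<in> carrier G
         then \<Sum>C\<in>lcosets Q. a (inv (coset_rep C) \<otimes> y \<otimes> coset_rep C) else 0)"
    by (auto simp: conj_action_eq coset_rep[OF assms])
  finally show ?thesis by (simp add: relative_trace_def coset_rep_def)
qed

text \<open>Left translation by \<open>x\<close> permutes the left cosets, and the sum of a function that is constant on each of them does not depend on representatives.\<close>
lemma sum_lcosets_translate:
  assumes Q: "subgroup Q G" and x: "x \<in> carrier G"
    and F: "\<And>g h. \<lbrakk>g \<in> carrier G; h \<in> carrier G; g <# Q = h <# Q\<rbrakk> \<Longrightarrow> F g = (F h :: 'k)"
  shows "(\<Sum>C\<in>lcosets Q. F (x \<otimes> coset_rep C)) = (\<Sum>C\<in>lcosets Q. F (coset_rep C))"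
proof -
  have tr: "y <# C \<in> lcosets Q" if "C \<in> lcosets Q" "y \<in> carrier G" for y C
    using that subgroup.subset[OF Q] by (auto simp: LCOSETS_def lcos_m_assoc)
  have canc: "y <# (inv y <# C) = C" "inv y <# (y <# C) = C"
    if "C \<in> lcosets Q" "y \<in> carrier G" for y C
    using lcosets_subset[OF Q that(1)] that(2) by (simp_all add: lcos_m_assoc lcos_mult_one)
  have rep: "F (coset_rep (x <# C)) = F (x \<otimes> coset_rep C)" if C: "C \<in> lcosets Q" for C
  proof (rule F)
    have "x \<otimes> coset_rep C <# Q = x <# (coset_rep C <# Q)"
      using lcos_m_assoc[OF subgroup.subset[OF Q] x coset_rep(1)[OF Q C]] by (rule sym)
    then show "coset_rep (x <# C) <# Q = x \<otimes> coset_rep C <# Q"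
      using coset_rep(2)[OF Q C] coset_rep(2)[OF Q tr[OF C x]] by simp
  qed (use coset_rep(1)[OF Q C] coset_rep(1)[OF Q tr[OF C x]] x in auto)
  show ?thesis
    by (rule sum.reindex_bij_witness[where i = "\<lambda>C. inv x <# C" and j = "\<lambda>C. x <# C"])
       (use x in \<open>auto simp: tr canc rep\<close>)
qed

text \<open>This is what makes the relative trace independent of representatives.\<close>
lemma conj_fixed_point_cong:
  assumes Q: "subgroup Q G" and a: "a \<in> fixed_points G Q"
    and g: "g \<in> carrier G" "h \<in> carrier G" "g <# Q = h <# Q" and y: "y \<in> carrier G"
  shows "a (inv g \<otimes> y \<otimes> g) = (a (inv h \<otimes> y \<otimes> h) :: 'k)"
proof -
  define q where "q = inv g \<otimes> h"
  have q: "q \<in> Q" using g by (simp add: q_def lcos_eq_iff[OF Q])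
  have h: "h = g \<otimes> q" using g by (simp add: q_def m_assoc[symmetric])
  have qG: "q \<in> carrier G" using q subgroup.mem_carrier[OF Q] by blast
  have "a (inv q \<otimes> (inv g \<otimes> y \<otimes> g) \<otimes> q) = a (inv g \<otimes> y \<otimes> g)"
    using a q g y subgroup.subset[OF Q] by (simp add: fixed_points_iff)
  then show ?thesis using g y qG by (simp add: h inv_mult_group m_assoc)
qed

lemma relative_trace_central:
  assumes Q: "subgroup Q G" and a: "a \<in> fixed_points G Q"
  shows "relative_trace G Q (a :: 'g \<Rightarrow> 'k) \<in> ring_center kG"
  unfolding ring_center_iff
proof (intro conjI ballI)
  show "relative_trace G Q a \<in> carrier kG" by (simp add: relative_trace_eq[OF Q] kG_carrier_iff)
  fix x y assume xy: "x \<in> carrier G" "y \<in> carrier G"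
  have "(\<Sum>C\<in>lcosets Q. a (inv (x \<otimes> coset_rep C) \<otimes> y \<otimes> (x \<otimes> coset_rep C))) =
        (\<Sum>C\<in>lcosets Q. a (inv (coset_rep C) \<otimes> y \<otimes> coset_rep C))"
    by (rule sum_lcosets_translate[OF Q xy(1)]) (rule conj_fixed_point_cong[OF Q a], use xy in auto)
  then show "relative_trace G Q a (inv x \<otimes> y \<otimes> x) = relative_trace G Q a y"
    using xy coset_rep(1)[OF Q] by (simp add: relative_trace_eq[OF Q] inv_mult_group m_assoc)
qed

end

section \<open>Primitive idempotents in commutative rings\<close>

lemma (in ring) ring_center_is_cring: "cring (R\<lparr>carrier := ring_center R\<rparr>)"
proof -
  let ?Z = "ring_center R"
  have Z_sub: "?Z \<subseteq> carrier R" by (auto simp: ring_center_def)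
  have Z_D: "h \<in> carrier R" "a \<in> carrier R \<Longrightarrow> h \<otimes> a = a \<otimes> h" if "h \<in> ?Z" for h a
    using that by (auto simp: ring_center_def)
  have Z_I: "h \<in> ?Z" if "h \<in> carrier R" "\<And>a. a \<in> carrier R \<Longrightarrow> h \<otimes> a = a \<otimes> h" for h
    using that by (auto simp: ring_center_def)
  have "subring ?Z R"
  proof (rule subringI)
    show "\<one> \<in> ?Z" by (rule Z_I) auto
    show "\<ominus> h \<in> ?Z" if "h \<in> ?Z" for h
      using Z_D[OF that] by (intro Z_I) (auto simp: l_minus r_minus)
    fix h1 h2 assume h: "h1 \<in> ?Z" "h2 \<in> ?Z"
    show "h1 \<oplus> h2 \<in> ?Z"
      using Z_D[OF h(1)] Z_D[OF h(2)] by (intro Z_I) (auto simp: l_distr r_distr)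
    have "h1 \<otimes> h2 \<otimes> a = a \<otimes> (h1 \<otimes> h2)" if a: "a \<in> carrier R" for a
    proof -
      have "h1 \<otimes> h2 \<otimes> a = h1 \<otimes> (a \<otimes> h2)"
        using Z_D(1)[OF h(1)] Z_D(1)[OF h(2)] a Z_D(2)[OF h(2) a] by (simp add: m_assoc)
      also have "\<dots> = h1 \<otimes> a \<otimes> h2" using Z_D(1)[OF h(1)] Z_D(1)[OF h(2)] a by (simp add: m_assoc)
      also have "\<dots> = a \<otimes> h1 \<otimes> h2" using Z_D(2)[OF h(1) a] by simp
      also have "\<dots> = a \<otimes> (h1 \<otimes> h2)" using Z_D(1)[OF h(1)] Z_D(1)[OF h(2)] a by (simp add: m_assoc)
      finally show ?thesis .
    qed
    then show "h1 \<otimes> h2 \<in> ?Z" using Z_D(1)[OF h(1)] Z_D(1)[OF h(2)] by (intro Z_I) auto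
  qed (rule Z_sub)
  then have "subcring ?Z R" using Z_D by (intro subcringI) auto
  then show ?thesis using subcring_iff[OF Z_sub] by blast
qed

text \<open>A two-summand form of Rosenberg's lemma: \<open>b R\<close> is a local ring, so one of the two summands
  of \<open>b\<close> is invertible in it. Let \<open>z = b u\<close>. Strong \<open>\<pi>\<close>-regularity, which holds in finite-dimensional
  algebras, gives an idempotent \<open>e\<close> that is a multiple of \<open>z\<close> and an identity for a power of \<open>z\<close>
  (Fitting). As \<open>b\<close> is primitive, either \<open>e = b\<close>, and \<open>b\<close> is a multiple of \<open>u\<close>, or \<open>e = 0\<close>,
  and \<open>z\<close> is nilpotent. In the second case \<open>b v = b - z\<close> is invertible in \<open>b R\<close> by the geometric
  series.\<close>
lemma (in cring) primitive_idempotent_divisible_by_summand: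
  assumes pi_regular: "\<And>z. z \<in> carrier R \<Longrightarrow> \<exists>m. \<exists>h\<in>carrier R. z [^] m = z [^] Suc m \<otimes> h"
    and prim: "primitive_idempotent R b"
    and u: "u \<in> carrier R" and v: "v \<in> carrier R" and b: "b = u \<oplus> v"
  shows "(\<exists>y\<in>carrier R. b = u \<otimes> y) \<or> (\<exists>y\<in>carrier R. b = v \<otimes> y)"
proof -
  have bR: "b \<in> carrier R" and bb: "b \<otimes> b = b"
    using prim by (auto simp: primitive_idempotent_def)
  define z where "z = b \<otimes> u"
  have z: "z \<in> carrier R" using bR u by (simp add: z_def)
  have bz: "b \<otimes> z = z" using bR u bb by (simp add: z_def m_assoc[symmetric])
  obtain m h where h: "h \<in> carrier R" and m0: "z [^] m = z [^] Suc m \<otimes> h"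
    using pi_regular[OF z] by blast
  \<comment> \<open>A positive exponent is needed for \<open>e\<close> to be divisible by \<open>z\<close>.\<close>
  define n where "n = Suc m"
  have step: "z [^] n = z [^] n \<otimes> (z \<otimes> h)"
  proof -
    have "z [^] n = z [^] Suc m \<otimes> h \<otimes> z" using m0 by (simp add: n_def)
    then show ?thesis using z h by (simp add: n_def m_ac)
  qed
  have iter: "z [^] n = z [^] n \<otimes> (z \<otimes> h) [^] j" for j :: nat
  proof (induction j)
    case (Suc j)
    have "z [^] n \<otimes> (z \<otimes> h) [^] Suc j = z [^] n \<otimes> (z \<otimes> h) [^] j \<otimes> (z \<otimes> h)"
      using z h by (simp add: m_assoc)
    also have "\<dots> = z [^] n" using Suc.IH step by simp
    finally show ?case by simp
  qed (use z in simp)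
  define e where "e = (z \<otimes> h) [^] n"
  have e: "e \<in> carrier R" using z h by (simp add: e_def)
  have ze: "z [^] n \<otimes> e = z [^] n" using iter[of n] by (simp add: e_def)
  have e_eq: "e = z [^] n \<otimes> h [^] n" using z h by (simp add: e_def nat_pow_distrib)
  have ee: "e \<otimes> e = e"
  proof -
    have "e \<otimes> e = (z [^] n \<otimes> e) \<otimes> h [^] n" using z h e by (subst (1) e_eq) (simp add: m_ac)
    then show ?thesis using ze e_eq by simp
  qed
  have zn_eq: "z [^] n = z \<otimes> z [^] m" using z by (simp add: n_def m_comm)
  have e_div: "e = u \<otimes> (b \<otimes> (z [^] m \<otimes> h [^] n))"
  proof -
    have "e = b \<otimes> u \<otimes> z [^] m \<otimes> h [^] n" unfolding e_eq zn_eq using z_def by simp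
    then show ?thesis using z h u bR by (simp add: m_ac)
  qed
  have be: "b \<otimes> e = e"
  proof -
    have "b \<otimes> e = (b \<otimes> z) \<otimes> z [^] m \<otimes> h [^] n"
      unfolding e_eq zn_eq using z h bR by (simp add: m_assoc)
    then show ?thesis unfolding bz e_eq zn_eq .
  qed
  show ?thesis
  proof (cases "e = \<zero>")
    case False
    have "e = b"
    proof (rule ccontr)
      assume "e \<noteq> b"
      define f where "f = b \<ominus> e"
      have f: "f \<in> carrier R" using bR e by (simp add: f_def)
      have eb: "e \<otimes> b = e" using be bR e by (simp add: m_comm)
      have "f \<noteq> \<zero>" using \<open>e \<noteq> b\<close> bR e by (simp add: f_def)
      moreover have "f \<otimes> f = f"
      proof -
        have "f \<otimes> f = b \<otimes> b \<ominus> b \<otimes> e \<ominus> (e \<otimes> b \<ominus> e \<otimes> e)"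
          unfolding f_def using bR e by algebra
        also have "\<dots> = f" unfolding bb be eb ee f_def using bR e by algebra
        finally show ?thesis .
      qed
      moreover have "e \<otimes> f = \<zero>"
      proof -
        have "e \<otimes> f = e \<otimes> b \<ominus> e \<otimes> e" unfolding f_def using bR e by algebra
        then show ?thesis unfolding eb ee using e by simp
      qed
      moreover have "f \<otimes> e = \<zero>" using calculation(3) e f by (simp add: m_comm)
      moreover have "b = e \<oplus> f" unfolding f_def using bR e by algebra
      ultimately show False
        using prim False e f ee by (auto simp: primitive_idempotent_def)
    qed
    then show ?thesis using e_div z h bR by blast
  next
    case True
    then have zn: "z [^] n = \<zero>" using ze z by simp
    \<comment> \<open>The geometric series: \<open>b - z = b v\<close> divides \<open>b - b z^j\<close>.\<close>
    have "\<exists>s\<in>carrier R. b \<ominus> b \<otimes> z [^] j = v \<otimes> s" for j :: nat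
    proof (induction j)
      case 0
      show ?case using bR v by (intro bexI[of _ \<zero>]) auto
    next
      case (Suc j)
      then obtain s where s: "s \<in> carrier R" "b \<ominus> b \<otimes> z [^] j = v \<otimes> s" by blast
      define w where "w = z [^] j"
      have w: "w \<in> carrier R" using z by (simp add: w_def)
      have bv: "b \<otimes> v = b \<ominus> z"
      proof -
        have "b \<otimes> b = z \<oplus> b \<otimes> v" unfolding z_def using b u v bR by (metis r_distr)
        then have "b = z \<oplus> b \<otimes> v" using bb by simp
        then show ?thesis using bR z v by (metis a_comm m_closed add.inv_solve_right minus_eq)
      qed
      have "b \<ominus> b \<otimes> (w \<otimes> z) = (b \<ominus> b \<otimes> w) \<oplus> w \<otimes> (b \<ominus> b \<otimes> z)"
        using bR w z by algebra
      also have "\<dots> = v \<otimes> s \<oplus> w \<otimes> (b \<otimes> v)" using s(2) bz bv by (simp add: w_def)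
      also have "\<dots> = v \<otimes> (s \<oplus> w \<otimes> b)" using s(1) w bR v by algebra
      finally show ?case using s(1) w bR by (intro bexI[of _ "s \<oplus> w \<otimes> b"]) (auto simp: w_def)
    qed
    from this[of n] show ?thesis using zn bR by (auto simp: minus_eq)
  qed
qed

text \<open>The factor \<open>y\<close> carries the induction: after one summand is split off, the rest is known only up to a multiple.\<close>
lemma (in cring) primitive_idempotent_divisible_by_finite_summand:
  assumes pi_regular: "\<And>z. z \<in> carrier R \<Longrightarrow> \<exists>m. \<exists>h\<in>carrier R. z [^] m = z [^] Suc m \<otimes> h"
    and prim: "primitive_idempotent R b"
    and I: "finite I" and t: "t \<in> I \<rightarrow> carrier R" and y: "y \<in> carrier R"
    and b: "b = finsum R t I \<otimes> y"
  shows "\<exists>i\<in>I. \<exists>y\<in>carrier R. b = t i \<otimes> y"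
  using I t y b
proof (induction I arbitrary: y rule: finite_induct)
  case empty
  then show ?case using prim by (simp add: primitive_idempotent_def)
next
  case (insert i I)
  have ti: "t i \<in> carrier R" and tI: "t \<in> I \<rightarrow> carrier R" using insert.prems by auto
  have s: "finsum R t I \<in> carrier R" using tI by simp
  have "b = t i \<otimes> y \<oplus> finsum R t I \<otimes> y"
    using insert ti tI s by (simp add: l_distr)
  then consider x where "x \<in> carrier R" "b = t i \<otimes> y \<otimes> x"
    | x where "x \<in> carrier R" "b = finsum R t I \<otimes> y \<otimes> x"
    using primitive_idempotent_divisible_by_summand[OF pi_regular prim, of "t i \<otimes> y" "finsum R t I \<otimes> y"]
      ti s insert.prems by auto
  then show ?case
  proof cases
    case 1
    then show ?thesis using ti insert.prems(2) by (auto simp: m_assoc intro!: bexI[of _ "y \<otimes> x"])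
  next
    case 2
    then show ?thesis using insert.IH[OF tI, of "y \<otimes> x"] s insert.prems(2) by (auto simp: m_assoc)
  qed
qed

section \<open>The center of the group algebra\<close>

interpretation fun_space: vector_space "\<lambda>c (f :: 'a \<Rightarrow> 'k::field) x. c * f x"
  by unfold_locales (auto simp: fun_eq_iff algebra_simps)

lemma sum_fun_apply: "(\<Sum>i\<in>I. F i) x = (\<Sum>i\<in>I. F i x)"
  for F :: "'i \<Rightarrow> 'a \<Rightarrow> 'k::comm_monoid_add"
  by (induction I rule: infinite_finite_induct) auto

text \<open>The functions supported in \<open>A\<close> form a space of dimension \<open>card A\<close>, so \<open>card A + 1\<close> of them, repetitions included, are linearly dependent.\<close>
lemma functions_linear_dependence:
  fixes v :: "nat \<Rightarrow> 'a \<Rightarrow> 'k::field"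
  assumes A: "finite A" and v: "\<And>i x. x \<notin> A \<Longrightarrow> v i x = 0"
  shows "\<exists>c. (\<exists>i\<le>card A. c i \<noteq> 0) \<and> (\<forall>x. (\<Sum>i\<le>card A. c i * v i x) = 0)"
proof (cases "inj_on v {..card A}")
  case False
  then obtain i j where ij: "i \<le> card A" "j \<le> card A" "i \<noteq> j" "v i = v j"
    by (auto simp: inj_on_def)
  let ?c = "\<lambda>l. (if l = i then 1 else 0) - (if l = j then 1 else 0) :: 'k"
  have "(\<Sum>l\<le>card A. ?c l * v l x) = 0" for x
    using ij by (simp add: left_diff_distrib sum_subtractf if_distrib[of "\<lambda>u. u * _"] cong: if_cong)
  then show ?thesis using ij by (intro exI[of _ ?c]) auto
next
  case True
  let ?B = "(\<lambda>a. (\<lambda>x. if x = a then 1 else 0 :: 'k)) ` A"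
  have "v i \<in> fun_space.span ?B" for i
  proof -
    have "v i = (\<Sum>a\<in>A. (\<lambda>x. v i a * (if x = a then 1 else 0)))"
      using v A by (auto simp: fun_eq_iff sum_fun_apply if_distrib[of "\<lambda>u. _ * u"] cong: if_cong)
    also have "\<dots> \<in> fun_space.span ?B"
      by (intro fun_space.span_sum fun_space.span_scale fun_space.span_base) auto
    finally show ?thesis .
  qed
  then have span: "v ` {..card A} \<subseteq> fun_space.span ?B" by blast
  have "\<not> fun_space.independent (v ` {..card A})"
  proof
    assume "fun_space.independent (v ` {..card A})"
    then have "card (v ` {..card A}) \<le> card ?B"
      using fun_space.independent_span_bound[OF _ _ span] A by blast
    also have "\<dots> \<le> card A" using A by (rule card_image_le)
    finally show False using True by (simp add: card_image)
  qed
  then obtain d where d: "\<exists>f\<in>v ` {..card A}. d f \<noteq> 0"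
      "(\<Sum>f\<in>v ` {..card A}. (\<lambda>x. d f * f x)) = 0"
    by (auto simp: fun_space.dependent_finite)
  have "(\<Sum>i\<le>card A. d (v i) * v i x) = 0" for x
  proof -
    have "(\<Sum>i\<le>card A. d (v i) * v i x) = (\<Sum>f\<in>v ` {..card A}. d f * f x)"
      using True by (simp add: sum.reindex)
    then show ?thesis using fun_cong[OF d(2), of x] by (simp add: sum_fun_apply)
  qed
  then show ?thesis using d(1) by (intro exI[of _ "\<lambda>i. d (v i)"]) auto
qed

context finite_group_algebra
begin

abbreviation Z :: "('k, 'g \<Rightarrow> 'k) module" where
  "Z \<equiv> kG\<lparr>carrier := ring_center kG\<rparr>"

sublocale Z: cring Z
  by (rule kG.ring_center_is_cring)

text \<open>The powers of \<open>z\<close> satisfy a linear relation. Division of the relation by its coefficient of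
  lowest index \<open>m\<close> expresses \<open>z\<close> to the \<open>m\<close> by higher powers.\<close>
lemma center_pi_regular:
  assumes z: "z \<in> carrier Z"
  shows "\<exists>m. \<exists>h\<in>carrier Z. z [^]\<^bsub>Z\<^esub> m = z [^]\<^bsub>Z\<^esub> Suc m \<otimes>\<^bsub>Z\<^esub> h"
proof -
  define N where "N = card (carrier G)"
  define P where "P = (\<lambda>i :: nat. z [^]\<^bsub>Z\<^esub> i)"
  have PZ: "P i \<in> ring_center kG" for i
  proof -
    have "P i \<in> carrier Z" unfolding P_def by (rule Z.nat_pow_closed[OF z])
    then show ?thesis by simp
  qed
  have P_outside: "P i x = 0" if "x \<notin> carrier G" for i x
  proof -
    have "P i \<in> carrier kG" using PZ[of i] unfolding ring_center_iff by blast
    then show ?thesis using that by (rule kG_outside)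
  qed
  obtain c where c: "\<exists>i\<le>N. c i \<noteq> 0" "\<And>x. (\<Sum>i\<le>N. c i * P i x) = 0"
    using functions_linear_dependence[of "carrier G" P] P_outside by (auto simp: N_def)
  define m where "m = (LEAST i. c i \<noteq> 0)"
  have cm: "c m \<noteq> 0" unfolding m_def using c(1) by (metis (mono_tags, lifting) LeastI)
  have below: "c i = 0" if "i < m" for i using that not_less_Least by (auto simp: m_def)
  have m_le: "m \<le> N" 
  proof -
    obtain i where "i \<le> N" "c i \<noteq> 0" using c(1) by blast
    then show ?thesis unfolding m_def by (meson Least_le le_trans)
  qed
  define h where "h = (\<lambda>x. \<Sum>i\<in>{m<..N}. - (c i / c m) * P (i - Suc m) x)"
  have h: "h \<in> ring_center kG"
    using PZ by (simp add: ring_center_iff kG_carrier_iff h_def)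
  have "P (Suc m) \<otimes>\<^bsub>Z\<^esub> h = P m"
  proof
    fix x
    have "(P (Suc m) \<otimes>\<^bsub>Z\<^esub> h) x = (\<Sum>i\<in>{m<..N}. - (c i / c m) * (P (Suc m) \<otimes>\<^bsub>Z\<^esub> P (i - Suc m)) x)"
    proof (cases "x \<in> carrier G")
      case True
      then show ?thesis
        by (simp add: kG_mult h_def sum_distrib_left, subst sum.swap)
          (simp add: mult_ac sum_negf sum_divide_distrib)
    qed (simp add: kG_mult)
    also have "\<dots> = (\<Sum>i\<in>{m<..N}. - (c i / c m) * P i x)"
    proof (intro sum.cong refl)
      fix i assume "i \<in> {m<..N}"
      then have i: "Suc m + (i - Suc m) = i" by simp
      have "P (Suc m) \<otimes>\<^bsub>Z\<^esub> P (i - Suc m) = P (Suc m + (i - Suc m))"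
        unfolding P_def by (rule Z.nat_pow_mult[OF z])
      then show "- (c i / c m) * (P (Suc m) \<otimes>\<^bsub>Z\<^esub> P (i - Suc m)) x = - (c i / c m) * P i x"
        unfolding i by simp
    qed
    also have "\<dots> = P m x"
    proof -
      have "{..N} = {..<m} \<union> insert m {m<..N}" using m_le by auto
      then have "0 = (\<Sum>i\<in>{..<m} \<union> insert m {m<..N}. c i * P i x)" using c(2) by metis
      also have "\<dots> = c m * P m x + (\<Sum>i\<in>{m<..N}. c i * P i x)"
        by (subst sum.union_disjoint) (auto simp: below)
      finally have "(\<Sum>i\<in>{m<..N}. c i * P i x) = - (c m * P m x)"
        by (simp add: eq_neg_iff_add_eq_0 add.commute)
      moreover have "(\<Sum>i\<in>{m<..N}. - (c i / c m) * P i x) =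
          - (\<Sum>i\<in>{m<..N}. c i * P i x) / c m"
        by (simp add: sum_divide_distrib sum_negf)
      ultimately show ?thesis using cm by simp
    qed
    finally show "(P (Suc m) \<otimes>\<^bsub>Z\<^esub> h) x = P m x" .
  qed
  then show ?thesis using h by (auto simp: P_def intro!: exI[of _ m] bexI[of _ h])
qed

lemma Z_finsum:
  "\<lbrakk>finite I; f \<in> I \<rightarrow> carrier Z\<rbrakk> \<Longrightarrow> finsum Z f I = (\<lambda>x. \<Sum>i\<in>I. f i x)"
  by (induction I rule: finite_induct) (auto simp: kG_zero kG_add)

end

section \<open>Relative traces and the centralizer of a defect group\<close>

lemma (in group) inv_cancel_left [simp]:
  assumes "x \<in> carrier G" "y \<in> carrier G"
  shows "inv x \<otimes> (x \<otimes> y) = y" "x \<otimes> (inv x \<otimes> y) = y"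
  using assms by (simp_all add: m_assoc[symmetric])

context finite_group_algebra
begin

text \<open>Conjugation is multiplicative and fixes \<open>z\<close>, so the conjugate of \<open>a z\<close> is the conjugate of \<open>a\<close>
  times \<open>z\<close>; here in coordinates.\<close>
lemma mult_central_conj:
  assumes z: "z \<in> ring_center kG" and r: "r \<in> carrier G" and y: "y \<in> carrier G"
  shows "(a \<otimes>\<^bsub>kG\<^esub> z) (inv r \<otimes> y \<otimes> r) =
    (\<Sum>u\<in>carrier G. a (inv r \<otimes> (y \<otimes> inv u) \<otimes> r) * z u)"
proof -
  have zr: "z (inv r \<otimes> u \<otimes> r) = z u" if "u \<in> carrier G" for u
    using z r that by (simp add: ring_center_iff)
  have "(a \<otimes>\<^bsub>kG\<^esub> z) (inv r \<otimes> y \<otimes> r) =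
      (\<Sum>u\<in>carrier G. a (inv r \<otimes> y \<otimes> r \<otimes> inv u) * z u)"
    using r y by (simp add: kG_mult_right)
  also have "\<dots> = (\<Sum>u\<in>carrier G. a (inv r \<otimes> y \<otimes> r \<otimes> inv (inv r \<otimes> u \<otimes> r)) * z (inv r \<otimes> u \<otimes> r))"
    by (rule sum.reindex_bij_witness[where i = "\<lambda>u. inv r \<otimes> u \<otimes> r" and j = "\<lambda>u. r \<otimes> u \<otimes> inv r"])
       (use r in \<open>auto simp: m_assoc\<close>)
  also have "\<dots> = (\<Sum>u\<in>carrier G. a (inv r \<otimes> (y \<otimes> inv u) \<otimes> r) * z u)"
  proof (intro sum.cong refl)
    fix u assume u: "u \<in> carrier G"
    have "inv r \<otimes> y \<otimes> r \<otimes> inv (inv r \<otimes> u \<otimes> r) = inv r \<otimes> y \<otimes> (r \<otimes> inv r) \<otimes> inv u \<otimes> r"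
      using r y u by (simp add: inv_mult_group m_assoc)
    also have "\<dots> = inv r \<otimes> (y \<otimes> inv u) \<otimes> r" using r y u by (simp add: m_assoc)
    finally show "a (inv r \<otimes> y \<otimes> r \<otimes> inv (inv r \<otimes> u \<otimes> r)) * z (inv r \<otimes> u \<otimes> r) =
        a (inv r \<otimes> (y \<otimes> inv u) \<otimes> r) * z u" using zr[OF u] by simp
  qed
  finally show ?thesis .
qed

lemma fixed_points_mult_central:
  assumes z: "z \<in> ring_center kG" and Q: "Q \<subseteq> carrier G" and a: "a \<in> fixed_points G Q"
  shows "a \<otimes>\<^bsub>kG\<^esub> z \<in> fixed_points G Q"
  unfolding fixed_points_iff[OF Q]
proof (intro conjI ballI)
  show "a \<otimes>\<^bsub>kG\<^esub> z \<in> carrier kG" by (rule kG_mult_closed)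
  fix x y assume x: "x \<in> Q" and y: "y \<in> carrier G"
  have "a (inv x \<otimes> (y \<otimes> inv u) \<otimes> x) = a (y \<otimes> inv u)" if "u \<in> carrier G" for u
    using a x y that by (simp add: fixed_points_iff[OF Q])
  then show "(a \<otimes>\<^bsub>kG\<^esub> z) (inv x \<otimes> y \<otimes> x) = (a \<otimes>\<^bsub>kG\<^esub> z) y"
    using mult_central_conj[OF z _ y, of x a] x Q y by (auto simp: kG_mult_right)
qed

text \<open>Hence the traces from \<open>Q\<close> of fixed points form an ideal of the center.\<close>
lemma relative_trace_mult_central:
  assumes z: "z \<in> ring_center kG" and Q: "subgroup Q G"
  shows "relative_trace G Q (a \<otimes>\<^bsub>kG\<^esub> z) = relative_trace G Q a \<otimes>\<^bsub>kG\<^esub> z"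
proof
  fix y
  show "relative_trace G Q (a \<otimes>\<^bsub>kG\<^esub> z) y = (relative_trace G Q a \<otimes>\<^bsub>kG\<^esub> z) y"
  proof (cases "y \<in> carrier G")
    case True
    have "relative_trace G Q (a \<otimes>\<^bsub>kG\<^esub> z) y =
      (\<Sum>C\<in>lcosets Q. \<Sum>u\<in>carrier G.
         a (inv (coset_rep C) \<otimes> (y \<otimes> inv u) \<otimes> coset_rep C) * z u)"
      using True by (simp add: relative_trace_eq[OF Q] mult_central_conj[OF z] coset_rep(1)[OF Q])
    also have "\<dots> = (relative_trace G Q a \<otimes>\<^bsub>kG\<^esub> z) y"
      using True by (subst sum.swap) (simp add: kG_mult_right relative_trace_eq[OF Q] sum_distrib_right)
    finally show ?thesis .
  qed (simp add: relative_trace_eq[OF Q] kG_mult)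
qed

lemma subgroup_centralizer:
  assumes P: "subgroup P G" and g: "g \<in> carrier G"
  shows "subgroup {h \<in> P. h \<otimes> g = g \<otimes> h} G"
proof (rule subgroupI)
  have PG: "h \<in> carrier G" if "h \<in> P" for h using that subgroup.mem_carrier[OF P] by blast
  show "{h \<in> P. h \<otimes> g = g \<otimes> h} \<noteq> {}" using subgroup.one_closed[OF P] g by force
  show "{h \<in> P. h \<otimes> g = g \<otimes> h} \<subseteq> carrier G" using PG by auto
  show "inv h \<in> {h \<in> P. h \<otimes> g = g \<otimes> h}" if h: "h \<in> {h \<in> P. h \<otimes> g = g \<otimes> h}" for h
  proof -
    have hG: "h \<in> carrier G" and comm: "h \<otimes> g = g \<otimes> h" using h PG by auto
    have "g \<otimes> inv h = inv h \<otimes> (h \<otimes> g) \<otimes> inv h" using hG g by (simp add: m_assoc)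
    also have "\<dots> = inv h \<otimes> (g \<otimes> h) \<otimes> inv h" unfolding comm ..
    also have "\<dots> = inv h \<otimes> g" using hG g by (simp add: m_assoc)
    finally have "inv h \<otimes> g = g \<otimes> inv h" by (rule sym)
    then show ?thesis using h subgroup.m_inv_closed[OF P] by auto
  qed
  show "h \<otimes> h' \<in> {h \<in> P. h \<otimes> g = g \<otimes> h}"
    if h: "h \<in> {h \<in> P. h \<otimes> g = g \<otimes> h}" "h' \<in> {h \<in> P. h \<otimes> g = g \<otimes> h}" for h h'
  proof -
    have hG: "h \<in> carrier G" "h' \<in> carrier G"
      and comm: "h \<otimes> g = g \<otimes> h" "h' \<otimes> g = g \<otimes> h'" using h PG by auto
    have "h \<otimes> h' \<otimes> g = h \<otimes> (h' \<otimes> g)" using hG g by (simp add: m_assoc)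
    also have "\<dots> = (h \<otimes> g) \<otimes> h'" unfolding comm(2) using hG g by (simp add: m_assoc)
    also have "\<dots> = g \<otimes> (h \<otimes> h')" unfolding comm(1) using hG g by (simp add: m_assoc)
    finally show ?thesis using h subgroup.m_closed[OF P] by auto
  qed
qed

lemma conj_eq_iff_centralizer:
  assumes P: "subgroup P G" and g: "g \<in> carrier G" and h: "h \<in> P" "h' \<in> P"
  shows "h \<otimes> g \<otimes> inv h = h' \<otimes> g \<otimes> inv h' \<longleftrightarrow>
    inv h \<otimes> h' \<in> {h \<in> P. h \<otimes> g = g \<otimes> h}"
proof -
  have hG: "h \<in> carrier G" "h' \<in> carrier G" using h subgroup.mem_carrier[OF P] by auto
  have "h \<otimes> g \<otimes> inv h = h' \<otimes> g \<otimes> inv h' \<longleftrightarrow>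
      inv h \<otimes> (h \<otimes> g \<otimes> inv h) \<otimes> h' = inv h \<otimes> (h' \<otimes> g \<otimes> inv h') \<otimes> h'"
    using hG g by simp
  also have "\<dots> \<longleftrightarrow> g \<otimes> (inv h \<otimes> h') = inv h \<otimes> h' \<otimes> g"
  proof -
    have "inv h \<otimes> (h \<otimes> g \<otimes> inv h) \<otimes> h' = (inv h \<otimes> h) \<otimes> g \<otimes> (inv h \<otimes> h')"
      using hG g by (simp add: m_assoc)
    moreover have "inv h \<otimes> (h' \<otimes> g \<otimes> inv h') \<otimes> h' = inv h \<otimes> h' \<otimes> g \<otimes> (inv h' \<otimes> h')"
      using hG g by (simp add: m_assoc)
    ultimately show ?thesis using hG g by simp
  qed
  finally show ?thesis
    using h subgroup.m_closed[OF P] subgroup.m_inv_closed[OF P] by auto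
qed

text \<open>Transitivity of the trace, for the stabilizer \<open>Q\<close> of \<open>g\<close> in \<open>P\<close>: a left coset of \<open>Q\<close> in \<open>G\<close>
  amounts to a left coset of \<open>P\<close> in \<open>G\<close> together with a left coset of \<open>Q\<close> in \<open>P\<close>, and the latter to
  a \<open>P\<close>-conjugate of \<open>g\<close>. For a \<open>P\<close>-fixed \<open>a\<close>, a coefficient of the conjugate of \<open>u a\<close> by \<open>x\<close> is a function \<open>F x u\<close> as required.\<close>
lemma sum_lcosets_centralizer:
  fixes F :: "'g \<Rightarrow> 'g \<Rightarrow> 'k"
  assumes P: "subgroup P G" and g: "g \<in> carrier G"
  defines "Q \<equiv> {h \<in> P. h \<otimes> g = g \<otimes> h}"
  assumes F: "\<And>x h. \<lbrakk>x \<in> carrier G; h \<in> P\<rbrakk> \<Longrightarrow> F (x \<otimes> h) g = F x (h \<otimes> g \<otimes> inv h)"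
  shows "(\<Sum>C\<in>lcosets Q. F (coset_rep C) g) =
    (\<Sum>D\<in>lcosets P. \<Sum>w\<in>(\<lambda>h. h \<otimes> g \<otimes> inv h) ` P. F (coset_rep D) w)"
proof -
  have Q: "subgroup Q G" unfolding Q_def by (rule subgroup_centralizer[OF P g])
  have PG: "h \<in> carrier G" if "h \<in> P" for h using that subgroup.mem_carrier[OF P] by blast
  define orb where "orb = (\<lambda>h. h \<otimes> g \<otimes> inv h) ` P"
  \<comment> \<open>A coset \<open>C\<close> of \<open>Q\<close> lies in the coset \<open>D C\<close> of \<open>P\<close>, and \<open>h C\<close> is the element of \<open>P\<close> that links the
    two representatives. The bijection sends \<open>C\<close> to \<open>D C\<close> and the conjugate of \<open>g\<close> by \<open>h C\<close>.\<close>
  define D where "D = (\<lambda>C. coset_rep C <# P)"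
  define h where "h = (\<lambda>C. inv (coset_rep (D C)) \<otimes> coset_rep C)"
  define j where "j = (\<lambda>C. (D C, h C \<otimes> g \<otimes> inv (h C)))"
  have D: "D C \<in> lcosets P" if "C \<in> lcosets Q" for C
    using coset_rep(1)[OF Q that] by (auto simp: D_def lcosetsI)
  have h: "h C \<in> P" "coset_rep C = coset_rep (D C) \<otimes> h C" if C: "C \<in> lcosets Q" for C
  proof -
    have "coset_rep (D C) <# P = coset_rep C <# P"
      using coset_rep(2)[OF P D[OF C]] by (simp add: D_def)
    then show "h C \<in> P"
      using coset_rep(1)[OF P D[OF C]] coset_rep(1)[OF Q C] by (simp add: h_def lcos_eq_iff[OF P])
    show "coset_rep C = coset_rep (D C) \<otimes> h C"
      using coset_rep(1)[OF P D[OF C]] coset_rep(1)[OF Q C] by (simp add: h_def m_assoc[symmetric])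
  qed
  have rep_cong: "x <# Q = y <# Q" if "d \<in> carrier G"
      "x = d \<otimes> k" "y = d \<otimes> l" "k \<in> P" "l \<in> P" "inv k \<otimes> l \<in> Q" for x y d k l
    using that PG[of k] PG[of l] by (simp add: lcos_eq_iff[OF Q] inv_mult_group m_assoc)
  have "bij_betw j (lcosets Q) ((lcosets P) \<times> orb)"
  proof (rule bij_betw_imageI)
    show "inj_on j (lcosets Q)"
    proof (rule inj_onI)
      fix C C' assume C: "C \<in> lcosets Q" "C' \<in> lcosets Q" and eq: "j C = j C'"
      have "inv (h C) \<otimes> h C' \<in> Q"
        using eq conj_eq_iff_centralizer[OF P g h(1)[OF C(1)] h(1)[OF C(2)]] by (simp add: j_def Q_def)
      moreover have "D C = D C'" using eq by (simp add: j_def)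
      ultimately have "coset_rep C <# Q = coset_rep C' <# Q"
        using h[OF C(1)] h[OF C(2)] coset_rep(1)[OF Q] coset_rep(1)[OF P D] C
        by (intro rep_cong[where d = "coset_rep (D C)" and k = "h C" and l = "h C'"]) auto
      then show "C = C'" using coset_rep(2)[OF Q] C by simp
    qed
    show "j ` (lcosets Q) = (lcosets P) \<times> orb"
    proof (intro equalityI subsetI)
      fix t assume "t \<in> j ` (lcosets Q)"
      then show "t \<in> (lcosets P) \<times> orb" using D h(1) by (auto simp: j_def orb_def)
    next
      fix t assume "t \<in> (lcosets P) \<times> orb"
      then obtain E k where t: "t = (E, k \<otimes> g \<otimes> inv k)" "E \<in> lcosets P" "k \<in> P"
        by (auto simp: orb_def)
      have r: "coset_rep E \<in> carrier G" by (rule coset_rep(1)[OF P t(2)])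
      define C where "C = (coset_rep E \<otimes> k) <# Q"
      have C: "C \<in> lcosets Q" unfolding C_def using r PG[OF t(3)] by (intro lcosetsI) auto
      have "coset_rep C <# Q = (coset_rep E \<otimes> k) <# Q"
        using coset_rep(2)[OF Q C] by (simp add: C_def)
      then have q: "inv (coset_rep E \<otimes> k) \<otimes> coset_rep C \<in> Q"
        using lcos_eq_iff[OF Q, of "coset_rep E \<otimes> k" "coset_rep C"] r PG[OF t(3)] coset_rep(1)[OF Q C]
        by simp
      define q where "q = inv (coset_rep E \<otimes> k) \<otimes> coset_rep C"
      have qP: "q \<in> P" using q by (simp add: q_def Q_def)
      have repC: "coset_rep C = coset_rep E \<otimes> (k \<otimes> q)"
        using r PG[OF t(3)] coset_rep(1)[OF Q C] by (simp add: q_def inv_mult_group m_assoc)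
      have kq: "k \<otimes> q \<in> P" using t(3) qP subgroup.m_closed[OF P] by blast
      have "D C = coset_rep E <# P"
        unfolding D_def using r PG[OF kq] kq
        by (intro sym[OF iffD2[OF lcos_eq_iff[OF P]]]) (auto simp: repC m_assoc[symmetric])
      then have DE: "D C = E" using coset_rep(2)[OF P t(2)] by simp
      have hC: "h C = k \<otimes> q" using r PG[OF kq] by (simp add: h_def DE repC m_assoc[symmetric])
      have "h C \<otimes> g \<otimes> inv (h C) = k \<otimes> g \<otimes> inv k"
      proof -
        have "inv k \<otimes> h C \<in> {h \<in> P. h \<otimes> g = g \<otimes> h}"
          using q qP PG[OF t(3)] PG[OF qP] by (simp add: hC q_def[symmetric] Q_def m_assoc[symmetric])
        then show ?thesis
          using conj_eq_iff_centralizer[OF P g t(3) kq] by (simp add: hC)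
      qed
      then have "t = j C" using t(1) DE by (simp add: j_def)
      then show "t \<in> j ` (lcosets Q)" using C by blast
    qed
  qed
  then have "(\<Sum>C\<in>lcosets Q. F (coset_rep (fst (j C))) (snd (j C))) =
      (\<Sum>(E, w)\<in>(lcosets P) \<times> orb. F (coset_rep E) w)"
    by (subst sum.reindex_bij_betw[symmetric]) (auto simp: case_prod_unfold)
  moreover have "F (coset_rep (fst (j C))) (snd (j C)) = F (coset_rep C) g" if C: "C \<in> lcosets Q" for C
    using F[OF coset_rep(1)[OF P D[OF C]] h(1)[OF C]] h(2)[OF C] by (simp add: j_def)
  ultimately show ?thesis
    by (simp add: sum.cartesian_product orb_def)
qed

text \<open>Equivalently, the Brauer homomorphism of the defect group does not kill the block idempotent. Let
  \<open>b\<close> be the trace of \<open>a\<close> from \<open>P\<close>, and let \<open>b\<close> vanish on the centralizer of \<open>P\<close>. Then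
  \<open>b = b\<^sup>2\<close> is the trace of \<open>b a\<close>. Sorting the terms of the factor \<open>b\<close> by \<open>P\<close>-conjugacy classes \<open>X\<close> turns this
  into a sum over \<open>X\<close> of traces of \<open>b(g) g a\<close> from the centralizer in \<open>P\<close> of a representative \<open>g\<close> of
  \<open>X\<close>. Each of these centralizers is a proper subgroup of \<open>P\<close>. By Rosenberg's lemma \<open>b\<close> is a multiple
  of a single one of these traces, hence itself a trace from a proper subgroup.\<close>
lemma defect_group_meets_centralizer:
  assumes block: "block_idempotent G (b :: 'g \<Rightarrow> 'k)" and defect: "defect_group G b P"
  shows "\<exists>g\<in>carrier G. (\<forall>h\<in>P. h \<otimes> g = g \<otimes> h) \<and> b g \<noteq> 0"
proof (rule ccontr)
  assume contr: "\<not> ?thesis"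
  have prim: "primitive_idempotent Z b" using block by (simp add: block_idempotent_def)
  then have bZ: "b \<in> ring_center kG" and bb: "b \<otimes>\<^bsub>kG\<^esub> b = b"
    by (simp_all add: primitive_idempotent_def)
  have P: "subgroup P G"
    and minimal: "\<And>Q. \<lbrakk>subgroup Q G; Q \<subset> P\<rbrakk> \<Longrightarrow> b \<notin> relative_trace G Q ` fixed_points G Q"
    using defect by (auto simp: defect_group_def)
  obtain a where a: "a \<in> fixed_points G P" "b = relative_trace G P a"
    using defect by (auto simp: defect_group_def)
  have PG: "h \<in> carrier G" if "h \<in> P" for h using that subgroup.mem_carrier[OF P] by blast
  have aP: "a (inv h \<otimes> y \<otimes> h) = a y" if "h \<in> P" "y \<in> carrier G" for h y
    using a(1) that subgroup.subset[OF P] by (simp add: fixed_points_iff)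
  have bconj: "b (inv h \<otimes> y \<otimes> h) = b y" if "h \<in> carrier G" "y \<in> carrier G" for h y
    using bZ that by (simp add: ring_center_iff)
  define orb where "orb = (\<lambda>x. (\<lambda>h. h \<otimes> x \<otimes> inv h) ` P)"
  have orb_self: "x \<in> orb x" if "x \<in> carrier G" for x
    unfolding orb_def using that subgroup.one_closed[OF P] by (intro image_eqI[of _ _ \<one>]) auto
  have orb_G: "orb x \<subseteq> carrier G" if "x \<in> carrier G" for x
    using that PG by (auto simp: orb_def)
  have orb_eq: "orb y = orb x" if x: "x \<in> carrier G" and y: "y \<in> orb x" for x y
  proof -
    obtain k where k: "k \<in> P" "y = k \<otimes> x \<otimes> inv k" using y by (auto simp: orb_def)
    show ?thesis
    proof (intro equalityI subsetI)
      fix w assume "w \<in> orb y"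
      then obtain h where h: "h \<in> P" "w = h \<otimes> y \<otimes> inv h" by (auto simp: orb_def)
      then have "w = (h \<otimes> k) \<otimes> x \<otimes> inv (h \<otimes> k)"
        using k x PG by (simp add: m_assoc inv_mult_group)
      then show "w \<in> orb x" unfolding orb_def using subgroup.m_closed[OF P] h k by blast
    next
      fix w assume "w \<in> orb x"
      then obtain h where h: "h \<in> P" "w = h \<otimes> x \<otimes> inv h" by (auto simp: orb_def)
      then have "w = (h \<otimes> inv k) \<otimes> y \<otimes> inv (h \<otimes> inv k)"
        using k x PG by (simp add: m_assoc inv_mult_group)
      then show "w \<in> orb y"
        unfolding orb_def using subgroup.m_closed[OF P] subgroup.m_inv_closed[OF P] h k by blast
    qed
  qed
  define Os where "Os = orb ` {x \<in> carrier G. b x \<noteq> 0}"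
  define rep where "rep = (\<lambda>X :: 'g set. SOME x. x \<in> X)"
  have rep: "rep X \<in> carrier G" "b (rep X) \<noteq> 0" "orb (rep X) = X" if X: "X \<in> Os" for X
  proof -
    obtain x where x: "x \<in> carrier G" "b x \<noteq> 0" "X = orb x" using X by (auto simp: Os_def)
    have mem: "rep X \<in> X" unfolding rep_def using orb_self[OF x(1)] x(3) by (auto intro: someI)
    show "rep X \<in> carrier G" using mem orb_G[OF x(1)] x(3) by blast
    show "orb (rep X) = X" using orb_eq[OF x(1), of "rep X"] mem x(3) by simp
    obtain h where h: "h \<in> P" "rep X = h \<otimes> x \<otimes> inv h" using mem x(3) by (auto simp: orb_def)
    have "b (rep X) = b x" using bconj[of "inv h" x] h PG[OF h(1)] x(1) by simp
    then show "b (rep X) \<noteq> 0" using x(2) by simp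
  qed
  \<comment> \<open>\<open>w X\<close> is \<open>b(g) g a\<close> for the representative \<open>g\<close> of \<open>X\<close>, a fixed point of the centralizer \<open>Q X\<close>,
    and \<open>t X\<close> is its trace.\<close>
  define Q where "Q = (\<lambda>X. {h \<in> P. h \<otimes> rep X = rep X \<otimes> h})"
  define w where "w = (\<lambda>X y. if y \<in> carrier G then b (rep X) * a (inv (rep X) \<otimes> y) else 0)"
  define t where "t = (\<lambda>X. relative_trace G (Q X) (w X))"
  have Q: "subgroup (Q X) G" "Q X \<subset> P" if X: "X \<in> Os" for X
  proof -
    show "subgroup (Q X) G" unfolding Q_def by (rule subgroup_centralizer[OF P rep(1)[OF X]])
    show "Q X \<subset> P" using contr rep[OF X] by (auto simp: Q_def)
  qed
  have w: "w X \<in> fixed_points G (Q X)" if X: "X \<in> Os" for X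
    unfolding fixed_points_iff[OF subgroup.subset[OF Q(1)[OF X]]]
  proof (intro conjI ballI)
    show "w X \<in> carrier kG" by (simp add: w_def kG_carrier_iff)
    fix h y assume h: "h \<in> Q X" and y: "y \<in> carrier G"
    define g where "g = rep X"
    have g: "g \<in> carrier G" using rep(1)[OF X] by (simp add: g_def)
    have hP: "h \<in> P" and comm: "h \<otimes> g = g \<otimes> h" using h by (auto simp: Q_def g_def)
    have hG: "h \<in> carrier G" using PG[OF hP] .
    have "inv g \<otimes> inv h = inv (h \<otimes> g)" using g hG by (simp add: inv_mult_group)
    also have "\<dots> = inv h \<otimes> inv g" unfolding comm using g hG by (simp add: inv_mult_group)
    finally have comm': "inv g \<otimes> inv h = inv h \<otimes> inv g" .
    have "inv g \<otimes> (inv h \<otimes> y \<otimes> h) = (inv g \<otimes> inv h) \<otimes> y \<otimes> h" using g hG y by (simp add: m_assoc)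
    also have "\<dots> = inv h \<otimes> (inv g \<otimes> y) \<otimes> h" unfolding comm' using g hG y by (simp add: m_assoc)
    finally have "a (inv g \<otimes> (inv h \<otimes> y \<otimes> h)) = a (inv g \<otimes> y)" using aP[OF hP] g y by simp
    then show "w X (inv h \<otimes> y \<otimes> h) = w X y" using hG y by (simp add: w_def g_def)
  qed
  have tZ: "t X \<in> carrier Z" if "X \<in> Os" for X
    using relative_trace_central[OF Q(1)[OF that] w[OF that]] by (simp add: t_def)
  have tX: "t X y = (\<Sum>D\<in>lcosets P. \<Sum>u\<in>X. b u * a (inv u \<otimes> (inv (coset_rep D) \<otimes> y \<otimes> coset_rep D)))"
    if X: "X \<in> Os" and y: "y \<in> carrier G" for X y
  proof -
    define g where "g = rep X"
    have g: "g \<in> carrier G" using rep(1)[OF X] by (simp add: g_def)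
    define F where "F = (\<lambda>x u. a (inv u \<otimes> (inv x \<otimes> y \<otimes> x)))"
    have F: "F (x \<otimes> h) g = F x (h \<otimes> g \<otimes> inv h)" if x: "x \<in> carrier G" and h: "h \<in> P" for x h
    proof -
      have hG: "h \<in> carrier G" using PG[OF h] .
      have "F x (h \<otimes> g \<otimes> inv h) = a (inv h \<otimes> (inv (h \<otimes> g \<otimes> inv h) \<otimes> (inv x \<otimes> y \<otimes> x)) \<otimes> h)"
        unfolding F_def using aP[OF h] hG g x y by simp
      also have "\<dots> = F (x \<otimes> h) g"
        unfolding F_def using hG g x y by (simp add: m_assoc inv_mult_group)
      finally show ?thesis ..
    qed
    have "t X y = b g * (\<Sum>C\<in>lcosets (Q X). F (coset_rep C) g)"
      using y coset_rep(1)[OF Q(1)[OF X]]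
      by (simp add: t_def w_def relative_trace_eq[OF Q(1)[OF X]] F_def g_def sum_distrib_left)
    also have "\<dots> = b g * (\<Sum>D\<in>lcosets P. \<Sum>u\<in>orb g. F (coset_rep D) u)"
      using sum_lcosets_centralizer[OF P g, of F, OF F] by (simp add: Q_def g_def orb_def)
    also have "\<dots> = (\<Sum>D\<in>lcosets P. \<Sum>u\<in>orb g. b u * F (coset_rep D) u)"
    proof -
      have "b u = b g" if u: "u \<in> orb g" for u
      proof -
        obtain h where h: "h \<in> P" "u = h \<otimes> g \<otimes> inv h" using u by (auto simp: orb_def)
        then show ?thesis using bconj[of "inv h" g] PG[OF h(1)] g by simp
      qed
      then show ?thesis by (simp add: sum_distrib_left cong: sum.cong)
    qed
    finally show ?thesis using rep(3)[OF X] by (simp add: g_def F_def)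
  qed
  have finOs: "finite Os" by (simp add: Os_def)
  \<comment> \<open>Expand \<open>b = b\<^sup>2\<close> as the trace of \<open>b a\<close> and group the terms of \<open>b\<close> into orbits.\<close>
  have "finsum Z t Os = b"
  proof
    fix y
    have sum: "finsum Z t Os y = (\<Sum>X\<in>Os. t X y)"
      using Z_finsum[OF finOs, of t] tZ by simp
    show "finsum Z t Os y = b y"
    proof (cases "y \<in> carrier G")
      case False
      have "t X y = 0" if "X \<in> Os" for X
        using False by (simp add: t_def relative_trace_eq[OF Q(1)[OF that]])
      moreover have "b y = 0" using bZ False kG_outside by (simp add: ring_center_iff)
      ultimately show ?thesis using sum by simp
    next
      case True
      define v where "v = (\<lambda>D. inv (coset_rep D) \<otimes> y \<otimes> coset_rep D)"
      have v: "v D \<in> carrier G" if "D \<in> lcosets P" for D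
        using coset_rep(1)[OF P that] True by (simp add: v_def)
      have aG: "a \<in> carrier kG" using a(1) by (simp add: fixed_points_def)
      have "b = relative_trace G P a \<otimes>\<^bsub>kG\<^esub> b" using bb a(2) by simp
      also have "\<dots> = relative_trace G P (a \<otimes>\<^bsub>kG\<^esub> b)"
        by (rule relative_trace_mult_central[OF bZ P, symmetric])
      also have "a \<otimes>\<^bsub>kG\<^esub> b = b \<otimes>\<^bsub>kG\<^esub> a" using bZ aG by (auto simp: ring_center_def)
      finally have "b y = (\<Sum>D\<in>lcosets P. (b \<otimes>\<^bsub>kG\<^esub> a) (v D))"
        using True by (metis (no_types, lifting) relative_trace_eq[OF P] v_def sum.cong)
      also have "\<dots> = (\<Sum>D\<in>lcosets P. \<Sum>u\<in>carrier G. b u * a (inv u \<otimes> v D))"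
        using v by (intro sum.cong refl) (simp add: kG_mult)
      also have "\<dots> = (\<Sum>D\<in>lcosets P. \<Sum>u\<in>{x \<in> carrier G. b x \<noteq> 0}. b u * a (inv u \<otimes> v D))"
        by (intro sum.cong refl sum.mono_neutral_right) auto
      also have "\<dots> = (\<Sum>D\<in>lcosets P. \<Sum>X\<in>Os. \<Sum>u\<in>X. b u * a (inv u \<otimes> v D))"
      proof (intro sum.cong refl)
        fix D
        have "{x \<in> {x \<in> carrier G. b x \<noteq> 0}. orb x = X} = X" if X: "X \<in> Os" for X
        proof (intro equalityI subsetI)
          fix x assume "x \<in> {x \<in> {x \<in> carrier G. b x \<noteq> 0}. orb x = X}"
          then show "x \<in> X" using orb_self by auto
        next
          fix x assume "x \<in> X"
          then have x: "x \<in> orb (rep X)" using rep(3)[OF X] by simp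
          then obtain h where h: "h \<in> P" "x = h \<otimes> rep X \<otimes> inv h" by (auto simp: orb_def)
          have "b x = b (rep X)" using bconj[of "inv h" "rep X"] h PG[OF h(1)] rep(1)[OF X] by simp
          then show "x \<in> {x \<in> {x \<in> carrier G. b x \<noteq> 0}. orb x = X}"
            using x rep[OF X] orb_G[OF rep(1)[OF X]] orb_eq[OF rep(1)[OF X] x] by auto
        qed
        then show "(\<Sum>u\<in>{x \<in> carrier G. b x \<noteq> 0}. b u * a (inv u \<otimes> v D)) =
            (\<Sum>X\<in>Os. \<Sum>u\<in>X. b u * a (inv u \<otimes> v D))"
          using sum.image_gen[of "{x \<in> carrier G. b x \<noteq> 0}" "\<lambda>u. b u * a (inv u \<otimes> v D)" orb]
          by (simp add: Os_def[symmetric])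
      qed
      also have "\<dots> = (\<Sum>X\<in>Os. t X y)"
        by (subst sum.swap) (simp add: tX[OF _ True] v_def)
      finally show ?thesis using sum by simp
    qed
  qed
  then have "b = finsum Z t Os \<otimes>\<^bsub>Z\<^esub> b" using bb by simp
  moreover have "t \<in> Os \<rightarrow> carrier Z" using tZ by blast
  ultimately obtain X y where X: "X \<in> Os" and y: "y \<in> ring_center kG" and b: "b = t X \<otimes>\<^bsub>kG\<^esub> y"
    using Z.primitive_idempotent_divisible_by_finite_summand[OF center_pi_regular prim finOs, of t b] bZ
    by auto
  have "b = relative_trace G (Q X) (w X \<otimes>\<^bsub>kG\<^esub> y)"
    using relative_trace_mult_central[OF y Q(1)[OF X]] b by (simp add: t_def)
  moreover have "w X \<otimes>\<^bsub>kG\<^esub> y \<in> fixed_points G (Q X)"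
    by (rule fixed_points_mult_central[OF y subgroup.subset[OF Q(1)[OF X]] w[OF X]])
  ultimately show False using minimal[OF Q[OF X]] by blast
qed

end

section \<open>Extension of scalars by generators and relations\<close>

text \<open>The assumptions ensure that the tensor relations lie in the free abelian group on
  \<open>carrier R \<times> carrier V\<close>, and thus generate a subgroup of it. Elements of the extension are handled through
  \<open>tensor\<close>, the class of a formal sum of pairs.\<close>
locale scalar_extension = R?: ring R for R :: "('a, 'm) ring_scheme" (structure) +
  fixes S :: "('a, 'l) ring_scheme" and V :: "('a, 'b, 'n) module_scheme"
  assumes S_subset: "carrier S \<subseteq> carrier R"
    and V_add_closed: "\<lbrakk>v \<in> carrier V; v' \<in> carrier V\<rbrakk> \<Longrightarrow> v \<oplus>\<^bsub>V\<^esub> v' \<in> carrier V"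
    and V_smult_closed: "\<lbrakk>s \<in> carrier S; v \<in> carrier V\<rbrakk> \<Longrightarrow> s \<odot>\<^bsub>V\<^esub> v \<in> carrier V"
begin

abbreviation Free :: "('a \<times> 'b \<Rightarrow>\<^sub>0 int) monoid" where
  "Free \<equiv> free_Abelian_group (carrier R \<times> carrier V)"

text \<open>The action of a scalar on formal sums, which passes to the quotient by \<open>act_relators\<close>.\<close>
definition act :: "'a \<Rightarrow> ('a \<times> 'b \<Rightarrow>\<^sub>0 int) \<Rightarrow> ('a \<times> 'b \<Rightarrow>\<^sub>0 int)" where
  "act a = frag_extend (\<lambda>(r, v). frag_of (a \<otimes> r, v))"

definition relators :: "('a \<times> 'b \<Rightarrow>\<^sub>0 int) set" where
  "relators = generate Free (tensor_relations R S V)"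

definition tensor :: "('a \<times> 'b \<Rightarrow>\<^sub>0 int) \<Rightarrow> ('a \<times> 'b \<Rightarrow>\<^sub>0 int) set" where
  "tensor w = relators #>\<^bsub>Free\<^esub> w"

abbreviation E :: "('a, ('a \<times> 'b \<Rightarrow>\<^sub>0 int) set) module" where
  "E \<equiv> extend_scalars R S V"

lemma tensor_relations_cases:
  assumes "c \<in> tensor_relations R S V"
  obtains (add_left) r r' v where "r \<in> carrier R" "r' \<in> carrier R" "v \<in> carrier V"
      "c = frag_of (r \<oplus> r', v) - frag_of (r, v) - frag_of (r', v)"
    | (add_right) r v v' where "r \<in> carrier R" "v \<in> carrier V" "v' \<in> carrier V"
      "c = frag_of (r, v \<oplus>\<^bsub>V\<^esub> v') - frag_of (r, v) - frag_of (r, v')"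
    | (balance) r s v where "r \<in> carrier R" "s \<in> carrier S" "v \<in> carrier V"
      "c = frag_of (r \<otimes> s, v) - frag_of (r, s \<odot>\<^bsub>V\<^esub> v)"
  using assms unfolding tensor_relations_def
  by (elim UnE CollectE exE conjE) (rule that; assumption)+

lemma tensor_relationsI:
  "\<lbrakk>r \<in> carrier R; r' \<in> carrier R; v \<in> carrier V\<rbrakk> \<Longrightarrow>
    frag_of (r \<oplus> r', v) - frag_of (r, v) - frag_of (r', v) \<in> tensor_relations R S V"
  "\<lbrakk>r \<in> carrier R; v \<in> carrier V; v' \<in> carrier V\<rbrakk> \<Longrightarrow>
    frag_of (r, v \<oplus>\<^bsub>V\<^esub> v') - frag_of (r, v) - frag_of (r, v') \<in> tensor_relations R S V"
  "\<lbrakk>r \<in> carrier R; s \<in> carrier S; v \<in> carrier V\<rbrakk> \<Longrightarrow>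
    frag_of (r \<otimes> s, v) - frag_of (r, s \<odot>\<^bsub>V\<^esub> v) \<in> tensor_relations R S V"
  unfolding tensor_relations_def by blast+

lemma tensor_relations_subset: "tensor_relations R S V \<subseteq> carrier Free"
proof
  have keys2: "Poly_Mapping.keys (frag_of i - frag_of j) \<subseteq> {i, j}" for i j :: "'a \<times> 'b"
    using keys_diff[of "frag_of i" "frag_of j"] by auto
  fix c assume "c \<in> tensor_relations R S V"
  then have "Poly_Mapping.keys c \<subseteq> carrier R \<times> carrier V"
  proof (cases rule: tensor_relations_cases)
    case (add_left r r' v)
    then show ?thesis
      using keys2[of "(r \<oplus> r', v)" "(r, v)"] keys_diff[of "frag_of (r \<oplus> r', v) - frag_of (r, v)" "frag_of (r', v)"]
      by auto
  next
    case (add_right r v v')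
    then show ?thesis
      using keys2[of "(r, v \<oplus>\<^bsub>V\<^esub> v')" "(r, v)"] V_add_closed[OF add_right(2,3)]
        keys_diff[of "frag_of (r, v \<oplus>\<^bsub>V\<^esub> v') - frag_of (r, v)" "frag_of (r, v')"]
      by auto
  next
    case (balance r s v)
    then show ?thesis
      using keys2[of "(r \<otimes> s, v)" "(r, s \<odot>\<^bsub>V\<^esub> v)"] subsetD[OF S_subset balance(2)]
        V_smult_closed[OF balance(2,3)] by auto
  qed
  then show "c \<in> carrier Free" by simp
qed

lemma relators_subgroup: "subgroup relators Free"
  unfolding relators_def
  by (rule group.generate_is_subgroup[OF group_free_Abelian_group tensor_relations_subset])

lemma relators_normal: "relators \<lhd> Free"
  by (rule comm_group.subgroup_imp_normal[OF abelian_free_Abelian_group relators_subgroup])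

text \<open>The record \<open>free_on_pairs\<close> has the same underlying group as \<open>Free\<close>, but a different type.\<close>
lemma cosets_free_on_pairs:
  "A_RCOSETS (free_on_pairs R V) H = RCOSETS Free H"
  "set_add (free_on_pairs R V) X Y = X <#>\<^bsub>Free\<^esub> Y"
  by (simp_all add: free_on_pairs_def A_RCOSETS_def RCOSETS_def r_coset_def set_add_def set_mult_def)

lemma act_closed: "a \<in> carrier R \<Longrightarrow> w \<in> carrier Free \<Longrightarrow> act a w \<in> carrier Free"
  unfolding act_def carrier_free_Abelian_group_iff
  by (rule order_trans[OF keys_frag_extend]) (auto simp: subset_iff)

lemma act_add: "act a (w + w') = act a w + act a w'"
  and act_diff: "act a (w - w') = act a w - act a w'"
  and act_of: "act a (frag_of (r, v)) = frag_of (a \<otimes> r, v)"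
  by (simp_all add: act_def frag_extend_add frag_extend_diff)

lemma act_relators:
  assumes a: "a \<in> carrier R" and n: "n \<in> relators"
  shows "act a n \<in> relators"
proof -
  have rel: "act a c \<in> tensor_relations R S V" if "c \<in> tensor_relations R S V" for c
  proof -
    from that show ?thesis
    proof (cases rule: tensor_relations_cases)
      case (add_left r r' v)
      then have "act a c = frag_of (a \<otimes> r \<oplus> a \<otimes> r', v) - frag_of (a \<otimes> r, v) - frag_of (a \<otimes> r', v)"
        using a by (simp add: act_diff act_of r_distr)
      then show ?thesis using add_left a tensor_relationsI(1)[of "a \<otimes> r" "a \<otimes> r'" v] by simp
    next
      case (add_right r v v')
      then have "act a c = frag_of (a \<otimes> r, v \<oplus>\<^bsub>V\<^esub> v') - frag_of (a \<otimes> r, v) - frag_of (a \<otimes> r, v')"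
        by (simp add: act_diff act_of)
      then show ?thesis using add_right a tensor_relationsI(2)[of "a \<otimes> r" v v'] by simp
    next
      case (balance r s v)
      then have "act a c = frag_of (a \<otimes> r \<otimes> s, v) - frag_of (a \<otimes> r, s \<odot>\<^bsub>V\<^esub> v)"
        using a subsetD[OF S_subset balance(2)] by (simp add: act_diff act_of m_assoc)
      then show ?thesis using balance a tensor_relationsI(3)[of "a \<otimes> r" s v] by simp
    qed
  qed
  show ?thesis
    using n unfolding relators_def
  proof (induction rule: generate.induct)
    case one
    then show ?case using generate.one[of Free] by (simp add: act_def)
  next
    case (incl h)
    then show ?case using rel by (blast intro: generate.incl)
  next
    case (inv h)
    have h: "h \<in> carrier Free" "act a h \<in> carrier Free"
      using subsetD[OF tensor_relations_subset inv] act_closed[OF a] by blast+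
    have "act a (inv\<^bsub>Free\<^esub> h) = inv\<^bsub>Free\<^esub> (act a h)"
      using h by (simp add: act_def frag_extend_minus)
    then show ?case using generate.inv[OF rel[OF inv]] by simp
  next
    case (eng h1 h2)
    then show ?case using generate.eng[OF eng.IH] by (simp add: act_add)
  qed
qed

lemma tensor_mem: "tensor w = {n + w | n. n \<in> relators}"
  by (auto simp: tensor_def r_coset_def)

lemma relators_zero: "0 \<in> relators"
  using subgroup.one_closed[OF relators_subgroup] by simp

lemma relators_add: "n \<in> relators \<Longrightarrow> n' \<in> relators \<Longrightarrow> n + n' \<in> relators"
  using subgroup.m_closed[OF relators_subgroup] by simp

lemma relators_uminus: "n \<in> relators \<Longrightarrow> - n \<in> relators"
  using subgroup.m_inv_closed[OF relators_subgroup] subgroup.mem_carrier[OF relators_subgroup]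
  by fastforce

lemma tensor_eq_iff: "tensor w = tensor w' \<longleftrightarrow> w - w' \<in> relators"
proof
  assume "tensor w = tensor w'"
  moreover have "w \<in> tensor w" using relators_zero by (force simp: tensor_mem)
  ultimately show "w - w' \<in> relators" by (auto simp: tensor_mem)
next
  assume *: "w - w' \<in> relators"
  show "tensor w = tensor w'"
  proof (intro equalityI subsetI)
    fix c assume "c \<in> tensor w"
    then obtain n where n: "n \<in> relators" "c = n + w" by (auto simp: tensor_mem)
    then have "c = (n + (w - w')) + w'" by simp
    then show "c \<in> tensor w'" using relators_add[OF n(1) *] unfolding tensor_mem by blast
  next
    fix c assume "c \<in> tensor w'"
    then obtain n where n: "n \<in> relators" "c = n + w'" by (auto simp: tensor_mem)
    then have "c = (n + - (w - w')) + w" by simp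
    then show "c \<in> tensor w" using relators_add[OF n(1) relators_uminus[OF *]] unfolding tensor_mem by blast
  qed
qed

lemma E_as_quotient_group:
  "carrier E = carrier (Free Mod relators)"
  "x \<oplus>\<^bsub>E\<^esub> y = x \<otimes>\<^bsub>Free Mod relators\<^esub> y"
  "\<zero>\<^bsub>E\<^esub> = \<one>\<^bsub>Free Mod relators\<^esub>"
  by (simp_all add: extend_scalars_def quotient_module_def cosets_free_on_pairs
      relators_def FactGroup_def)

lemma carrier_E: "carrier E = tensor ` carrier Free"
  by (auto simp: E_as_quotient_group FactGroup_def RCOSETS_def tensor_def)

lemma abelian_group_E: "abelian_group E"
proof -
  interpret Q: comm_group "Free Mod relators"
    by (rule comm_group.abelian_FactGroup[OF abelian_free_Abelian_group relators_subgroup])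
  show ?thesis
  proof (rule abelian_groupI)
    fix x assume "x \<in> carrier E"
    then show "\<exists>y\<in>carrier E. y \<oplus>\<^bsub>E\<^esub> x = \<zero>\<^bsub>E\<^esub>"
      unfolding E_as_quotient_group using Q.l_inv Q.inv_closed by blast
  next
    fix x y assume "x \<in> carrier E" "y \<in> carrier E"
    then show "x \<oplus>\<^bsub>E\<^esub> y = y \<oplus>\<^bsub>E\<^esub> x" unfolding E_as_quotient_group by (rule Q.m_comm)
  qed (auto simp: E_as_quotient_group Q.m_assoc simp del: mult_FactGroup one_FactGroup)
qed

lemma tensor_add:
  assumes "w \<in> carrier Free" "w' \<in> carrier Free"
  shows "tensor w \<oplus>\<^bsub>E\<^esub> tensor w' = tensor (w + w')"
proof -
  have "tensor w \<oplus>\<^bsub>E\<^esub> tensor w' = tensor w <#>\<^bsub>Free\<^esub> tensor w'"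
    by (simp add: E_as_quotient_group)
  also have "\<dots> = tensor (w + w')"
    unfolding tensor_def using normal.rcos_sum[OF relators_normal assms] by simp
  finally show ?thesis .
qed

lemma tensor_smult:
  assumes a: "a \<in> carrier R"
  shows "a \<odot>\<^bsub>E\<^esub> tensor w = tensor (act a w)"
proof -
  have "a \<odot>\<^bsub>E\<^esub> tensor w = relators <#>\<^bsub>Free\<^esub> (act a ` tensor w)"
    by (simp add: extend_scalars_def quotient_module_def cosets_free_on_pairs
        relators_def[symmetric]) (simp add: free_on_pairs_def act_def)
  also have "\<dots> = tensor (act a w)"
  proof (intro equalityI subsetI)
    fix c assume "c \<in> relators <#>\<^bsub>Free\<^esub> (act a ` tensor w)"
    then obtain n n' where n: "n \<in> relators" "n' \<in> relators" "c = n + act a (n' + w)"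
      by (auto simp: set_mult_def tensor_mem)
    then have "c = (n + act a n') + act a w" by (simp add: act_add)
    then show "c \<in> tensor (act a w)"
      using relators_add[OF n(1) act_relators[OF a n(2)]] unfolding tensor_mem by blast
  next
    fix c assume "c \<in> tensor (act a w)"
    then obtain n where n: "n \<in> relators" "c = n + act a (0 + w)" by (auto simp: tensor_mem)
    then show "c \<in> relators <#>\<^bsub>Free\<^esub> (act a ` tensor w)"
      using relators_zero unfolding set_mult_def tensor_mem by force
  qed
  finally show ?thesis .
qed

lemma smult_add_E:
  assumes a: "a \<in> carrier R" and x: "x \<in> carrier E" and y: "y \<in> carrier E"
  shows "a \<odot>\<^bsub>E\<^esub> (x \<oplus>\<^bsub>E\<^esub> y) = a \<odot>\<^bsub>E\<^esub> x \<oplus>\<^bsub>E\<^esub> a \<odot>\<^bsub>E\<^esub> y"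
proof -
  obtain w w' where w: "w \<in> carrier Free" "x = tensor w" "w' \<in> carrier Free" "y = tensor w'"
    using x y by (auto simp: carrier_E)
  have "a \<odot>\<^bsub>E\<^esub> (x \<oplus>\<^bsub>E\<^esub> y) = tensor (act a (w + w'))"
    using w(2,4) tensor_add[OF w(1,3)] tensor_smult[OF a] by simp
  moreover have "a \<odot>\<^bsub>E\<^esub> x \<oplus>\<^bsub>E\<^esub> a \<odot>\<^bsub>E\<^esub> y = tensor (act a w + act a w')"
    using w(2,4) tensor_add[OF act_closed[OF a w(1)] act_closed[OF a w(3)]] tensor_smult[OF a] by simp
  ultimately show ?thesis by (simp add: act_add)
qed

lemma tensor_balanced:
  assumes "r \<in> carrier R" "s \<in> carrier S" "v \<in> carrier V"
  shows "tensor (frag_of (r \<otimes> s, v)) = tensor (frag_of (r, s \<odot>\<^bsub>V\<^esub> v))"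
proof -
  have "frag_of (r \<otimes> s, v) - frag_of (r, s \<odot>\<^bsub>V\<^esub> v) \<in> tensor_relations R S V"
    by (rule tensor_relationsI(3)[OF assms])
  then show ?thesis unfolding tensor_eq_iff relators_def by (rule generate.incl)
qed

end

text \<open>A summand is a retract: compose the projection along the complement with the inverse of the isomorphism.\<close>
lemma summand_retraction:
  assumes M: "abelian_group M"
    and distr: "\<And>a x y. \<lbrakk>a \<in> carrier R; x \<in> carrier M; y \<in> carrier M\<rbrakk> \<Longrightarrow>
      a \<odot>\<^bsub>M\<^esub> (x \<oplus>\<^bsub>M\<^esub> y) = a \<odot>\<^bsub>M\<^esub> x \<oplus>\<^bsub>M\<^esub> a \<odot>\<^bsub>M\<^esub> y"
    and L: "left_module R L" and summand: "isomorphic_to_summand R L M"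
  shows "\<exists>\<iota> \<rho>. \<iota> \<in> carrier L \<rightarrow> carrier M \<and> \<rho> \<in> carrier M \<rightarrow> carrier L \<and>
    (\<forall>s\<in>carrier L. \<rho> (\<iota> s) = s) \<and>
    (\<forall>a\<in>carrier R. \<forall>s\<in>carrier L. \<iota> (a \<odot>\<^bsub>L\<^esub> s) = a \<odot>\<^bsub>M\<^esub> \<iota> s) \<and>
    (\<forall>x\<in>carrier M. \<forall>y\<in>carrier M. \<rho> (x \<oplus>\<^bsub>M\<^esub> y) = \<rho> x \<oplus>\<^bsub>L\<^esub> \<rho> y) \<and>
    (\<forall>a\<in>carrier R. \<forall>x\<in>carrier M. \<rho> (a \<odot>\<^bsub>M\<^esub> x) = a \<odot>\<^bsub>L\<^esub> \<rho> x)"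
proof -
  interpret M: abelian_group M by fact
  interpret L: left_module R L by fact
  obtain U W f where U: "submodule U R M" and W: "submodule W R M" and UW: "U \<inter> W = {\<zero>\<^bsub>M\<^esub>}"
    and sum: "U <+>\<^bsub>M\<^esub> W = carrier M"
    and f: "f \<in> iso (add_monoid L) (add_monoid (M\<lparr>carrier := U\<rparr>))"
    and f_smult: "\<And>a s. \<lbrakk>a \<in> carrier R; s \<in> carrier L\<rbrakk> \<Longrightarrow> f (a \<odot>\<^bsub>L\<^esub> s) = a \<odot>\<^bsub>M\<^esub> f s"
    using summand by (auto simp: isomorphic_to_summand_def direct_sum_def module_isomorphic_def)
  have subU: "subgroup U (add_monoid M)" and subW: "subgroup W (add_monoid M)"
    using U W by (auto simp: submodule_def)
  have UM: "u \<in> carrier M" if "u \<in> U" for u using subgroup.mem_carrier[OF subU that] by simp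
  have WM: "w \<in> carrier M" if "w \<in> W" for w using subgroup.mem_carrier[OF subW that] by simp
  have fU: "f s \<in> U" if "s \<in> carrier L" for s
    using f that by (auto simp: iso_def hom_def)
  have f_add: "f (s \<oplus>\<^bsub>L\<^esub> s') = f s \<oplus>\<^bsub>M\<^esub> f s'" if "s \<in> carrier L" "s' \<in> carrier L" for s s'
    using f that by (auto simp: iso_def hom_def)
  have f_bij: "bij_betw f (carrier L) U" using f by (simp add: iso_def)
  define \<rho> where "\<rho> = (\<lambda>x. SOME s. s \<in> carrier L \<and> (\<exists>w\<in>W. x = f s \<oplus>\<^bsub>M\<^esub> w))"
  have \<rho>: "\<rho> (f s \<oplus>\<^bsub>M\<^esub> w) = s" if s: "s \<in> carrier L" and w: "w \<in> W" for s w
  proof -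
    define t where "t = \<rho> (f s \<oplus>\<^bsub>M\<^esub> w)"
    have "t \<in> carrier L \<and> (\<exists>w'\<in>W. f s \<oplus>\<^bsub>M\<^esub> w = f t \<oplus>\<^bsub>M\<^esub> w')"
      unfolding t_def \<rho>_def by (rule someI[of _ s]) (use s w in blast)
    then obtain w' where t: "t \<in> carrier L" and w': "w' \<in> W" and eq: "f s \<oplus>\<^bsub>M\<^esub> w = f t \<oplus>\<^bsub>M\<^esub> w'"
      by blast
    note mem = UM[OF fU[OF s]] UM[OF fU[OF t]] WM[OF w] WM[OF w']
    have "f s \<ominus>\<^bsub>M\<^esub> f t = (f s \<oplus>\<^bsub>M\<^esub> w) \<oplus>\<^bsub>M\<^esub> (\<ominus>\<^bsub>M\<^esub> w \<oplus>\<^bsub>M\<^esub> \<ominus>\<^bsub>M\<^esub> f t)"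
      using mem by (simp add: a_minus_def M.a_assoc M.r_neg2)
    also have "\<dots> = (w' \<oplus>\<^bsub>M\<^esub> f t) \<oplus>\<^bsub>M\<^esub> (\<ominus>\<^bsub>M\<^esub> f t \<oplus>\<^bsub>M\<^esub> \<ominus>\<^bsub>M\<^esub> w)"
      unfolding eq using mem M.a_comm[of "f t" w'] M.a_comm[of "\<ominus>\<^bsub>M\<^esub> w" "\<ominus>\<^bsub>M\<^esub> f t"] by simp
    also have "\<dots> = w' \<ominus>\<^bsub>M\<^esub> w"
      using mem by (simp add: a_minus_def M.a_assoc M.r_neg2)
    finally have d: "f s \<ominus>\<^bsub>M\<^esub> f t = w' \<ominus>\<^bsub>M\<^esub> w" .
    have "f s \<ominus>\<^bsub>M\<^esub> f t \<in> U"
      using subgroup.m_closed[OF subU fU[OF s] subgroup.m_inv_closed[OF subU fU[OF t]]]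
      by (simp add: a_minus_def a_inv_def)
    moreover have "w' \<ominus>\<^bsub>M\<^esub> w \<in> W"
      using subgroup.m_closed[OF subW w' subgroup.m_inv_closed[OF subW w]]
      by (simp add: a_minus_def a_inv_def)
    ultimately have "f s \<ominus>\<^bsub>M\<^esub> f t = \<zero>\<^bsub>M\<^esub>" using d UW by auto
    then have "f s = f t" 
      using mem(1,2) M.minus_equality[of "f s" "\<ominus>\<^bsub>M\<^esub> f t"] by (simp add: a_minus_def)
    then show ?thesis using f_bij s t by (auto simp: bij_betw_def inj_on_def t_def)
  qed
  have decomp: "\<exists>s\<in>carrier L. \<exists>w\<in>W. x = f s \<oplus>\<^bsub>M\<^esub> w" if x: "x \<in> carrier M" for x
  proof -
    have "x \<in> U <+>\<^bsub>M\<^esub> W" using x sum by simp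
    then obtain u w where uw: "u \<in> U" "w \<in> W" "x = u \<oplus>\<^bsub>M\<^esub> w"
      by (auto simp: set_add_def set_mult_def)
    then show ?thesis using f_bij by (auto simp: bij_betw_def)
  qed
  have zeroW: "\<zero>\<^bsub>M\<^esub> \<in> W" using UW by auto
  have 1: "\<rho> (f s) = s" if "s \<in> carrier L" for s
    using \<rho>[OF that zeroW] UM[OF fU[OF that]] by simp
  have 2: "\<rho> (x \<oplus>\<^bsub>M\<^esub> y) = \<rho> x \<oplus>\<^bsub>L\<^esub> \<rho> y" if xy: "x \<in> carrier M" "y \<in> carrier M" for x y
  proof -
    obtain s w where s: "s \<in> carrier L" "w \<in> W" "x = f s \<oplus>\<^bsub>M\<^esub> w" using decomp[OF xy(1)] by blast
    obtain t v where t: "t \<in> carrier L" "v \<in> W" "y = f t \<oplus>\<^bsub>M\<^esub> v" using decomp[OF xy(2)] by blast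
    have "x \<oplus>\<^bsub>M\<^esub> y = f (s \<oplus>\<^bsub>L\<^esub> t) \<oplus>\<^bsub>M\<^esub> (w \<oplus>\<^bsub>M\<^esub> v)"
      using s t UM[OF fU] WM by (simp add: f_add M.a_ac)
    moreover have "w \<oplus>\<^bsub>M\<^esub> v \<in> W" using subgroup.m_closed[OF subW s(2) t(2)] by simp
    ultimately show ?thesis using \<rho> s t by simp
  qed
  have 3: "\<rho> (a \<odot>\<^bsub>M\<^esub> x) = a \<odot>\<^bsub>L\<^esub> \<rho> x" if a: "a \<in> carrier R" and x: "x \<in> carrier M" for a x
  proof -
    obtain s w where s: "s \<in> carrier L" "w \<in> W" "x = f s \<oplus>\<^bsub>M\<^esub> w" using decomp[OF x] by blast
    have "a \<odot>\<^bsub>M\<^esub> x = f (a \<odot>\<^bsub>L\<^esub> s) \<oplus>\<^bsub>M\<^esub> a \<odot>\<^bsub>M\<^esub> w"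
      using s a distr[OF a UM[OF fU[OF s(1)]] WM[OF s(2)]] f_smult by simp
    moreover have "a \<odot>\<^bsub>M\<^esub> w \<in> W" using submodule.smult_closed[OF W a s(2)] .
    ultimately show ?thesis using \<rho> s L.smult_closed[OF a s(1)] by simp
  qed
  have 4: "\<rho> x \<in> carrier L" if "x \<in> carrier M" for x
    using decomp[OF that] \<rho> by auto
  show ?thesis
    by (intro exI[of _ f] exI[of _ \<rho>]) (use 1 2 3 4 f_smult UM fU in auto)
qed

text \<open>The homomorphism from the free abelian group on all indices that extends \<open>\<phi>\<close>.\<close>
definition additive_ext :: "('i \<Rightarrow> 'k::ring_1) \<Rightarrow> ('i \<Rightarrow>\<^sub>0 int) \<Rightarrow> 'k" where
  "additive_ext \<phi> w = (\<Sum>i\<in>Poly_Mapping.keys w. of_int (Poly_Mapping.lookup w i) * \<phi> i)"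

lemma additive_ext_superset:
  "finite A \<Longrightarrow> Poly_Mapping.keys w \<subseteq> A \<Longrightarrow>
    additive_ext \<phi> w = (\<Sum>i\<in>A. of_int (Poly_Mapping.lookup w i) * \<phi> i)"
  unfolding additive_ext_def by (rule sum.mono_neutral_left) (auto simp: in_keys_iff)

lemma additive_ext_zero [simp]: "additive_ext \<phi> 0 = 0"
  and additive_ext_of [simp]: "additive_ext \<phi> (frag_of i) = \<phi> i"
  by (simp_all add: additive_ext_def)

lemma additive_ext_diff: "additive_ext \<phi> (w - w') = additive_ext \<phi> w - additive_ext \<phi> w'"
proof -
  let ?A = "Poly_Mapping.keys w \<union> Poly_Mapping.keys w'"
  have "Poly_Mapping.keys (w - w') \<subseteq> ?A" by (rule keys_diff)
  then show ?thesis
    by (simp add: additive_ext_superset[of ?A] lookup_minus left_diff_distrib sum_subtractf)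
qed

lemma additive_ext_add: "additive_ext \<phi> (w + w') = additive_ext \<phi> w + additive_ext \<phi> w'"
  using additive_ext_diff[of \<phi> "w + w'" w'] by (simp add: algebra_simps)

lemma additive_ext_uminus: "additive_ext \<phi> (- w) = - additive_ext \<phi> w"
  using additive_ext_diff[of \<phi> 0 w] by simp

lemma additive_ext_frag_extend:
  "additive_ext \<phi> (frag_extend (\<lambda>i. frag_of (g i)) w) = additive_ext (\<lambda>i. \<phi> (g i)) w"
proof -
  have "Poly_Mapping.keys w \<subseteq> UNIV" by simp
  then show ?thesis
    by (induction w rule: frag_induction) (auto simp: frag_extend_diff additive_ext_diff)
qed

lemma additive_ext_sum:
  "additive_ext (\<lambda>i. \<Sum>j\<in>J. \<phi> j i) w = (\<Sum>j\<in>J. additive_ext (\<phi> j) w)"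
  unfolding additive_ext_def by (subst sum.swap) (simp add: sum_distrib_left)

section \<open>Trivial Scott modules and the index of the vertex\<close>

context finite_group_algebra
begin

lemma trivial_scalar_extension:
  assumes P: "subgroup P G"
  shows "scalar_extension kG (subgroup_algebra G P :: ('k, 'g \<Rightarrow> 'k) module)
    (trivial_module (G\<lparr>carrier := P\<rparr>) :: ('g \<Rightarrow> 'k, 'k) module)"
proof unfold_locales
  show "carrier (subgroup_algebra G P :: ('k, 'g \<Rightarrow> 'k) module) \<subseteq> carrier kG"
    using subgroup.mem_carrier[OF P] by (auto simp: group_algebra_def subset_iff)
qed (auto simp: trivial_module_def)

text \<open>The module \<open>M\<close> is the permutation module on the left cosets of \<open>P\<close>. The functional \<open>\<chi> C\<close>
  adds up the coefficients of a tensor on a coset \<open>C\<close>; it respects the tensor relations because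
  \<open>C\<close> is stable under right multiplication by \<open>P\<close>. For a \<open>G\<close>-fixed element its value is the same on
  all cosets, so the total \<open>\<chi> G\<close> of \<open>m\<close> is a multiple of the index. On the other hand, an
  equivariant functional \<open>\<pi>\<close> to the trivial module is a multiple of \<open>\<chi> G\<close>, because \<open>M\<close> is generated by
  \<open>1 \<otimes> 1\<close>. So if the index were \<open>0\<close> in \<open>k\<close>, then \<open>\<pi>\<close> would vanish on \<open>m\<close>.\<close>
lemma index_nonzero_if_trivial_summand:
  fixes \<pi> :: "_ \<Rightarrow> 'k"
  assumes P: "subgroup P G"
    and M: "M = induced_module G P (trivial_module (G\<lparr>carrier := P\<rparr>) :: ('g \<Rightarrow> 'k, 'k) module)"
    and m: "m \<in> carrier M"
    and \<pi>_add: "\<And>x y. \<lbrakk>x \<in> carrier M; y \<in> carrier M\<rbrakk> \<Longrightarrow> \<pi> (x \<oplus>\<^bsub>M\<^esub> y) = \<pi> x + \<pi> y"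
    and \<pi>_smult: "\<And>a x. \<lbrakk>a \<in> carrier kG; x \<in> carrier M\<rbrakk> \<Longrightarrow>
      \<pi> (a \<odot>\<^bsub>M\<^esub> x) = (\<Sum>g\<in>carrier G. a g) * \<pi> x"
    and m_fixed: "\<And>g. g \<in> carrier G \<Longrightarrow> group_element g \<odot>\<^bsub>M\<^esub> m = m"
    and \<pi>m: "\<pi> m \<noteq> 0"
  shows "of_nat (card (lcosets P)) \<noteq> (0 :: 'k)"
proof -
  let ?V = "trivial_module (G\<lparr>carrier := P\<rparr>) :: ('g \<Rightarrow> 'k, 'k) module"
  let ?S = "subgroup_algebra G P :: ('k, 'g \<Rightarrow> 'k) module"
  have PG: "h \<in> carrier G" if "h \<in> P" for h using that subgroup.mem_carrier[OF P] by blast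
  have finP: "finite P" using finite_subset[OF subgroup.subset[OF P]] by simp
  have SI: "s \<in> carrier ?S \<longleftrightarrow> (\<forall>x. x \<notin> P \<longrightarrow> s x = 0)" for s
    by (simp add: group_algebra_def)
  have V: "carrier ?V = UNIV" "v \<oplus>\<^bsub>?V\<^esub> v' = v + v'" "s \<odot>\<^bsub>?V\<^esub> v = (\<Sum>x\<in>P. s x) * v" for v v' s
    by (simp_all add: trivial_module_def)
  interpret T: scalar_extension kG ?S ?V by (rule trivial_scalar_extension[OF P])
  have ME: "M = T.E" by (simp add: M induced_module_def)
  note m = m[unfolded ME] and \<pi>_add = \<pi>_add[unfolded ME] and \<pi>_smult = \<pi>_smult[unfolded ME]
    and m_fixed = m_fixed[unfolded ME]
  obtain w0 where w0: "w0 \<in> carrier T.Free" "m = T.tensor w0" using m by (auto simp: T.carrier_E)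
  define \<phi> where "\<phi> = (\<lambda>C (r :: 'g \<Rightarrow> 'k, t :: 'k). (\<Sum>x\<in>C. r x) * t)"
  define \<chi> where "\<chi> = (\<lambda>C. additive_ext (\<phi> C))"
  have lcoset: "C \<subseteq> carrier G" "finite C" if "C \<in> lcosets P" for C
    using lcosets_subset[OF P that] finite_subset[OF lcosets_subset[OF P that]] by auto
  have \<chi>_relation: "\<chi> C c = 0" if C: "C \<in> lcosets P" and c: "c \<in> tensor_relations kG ?S ?V" for C c
    using c
  proof (cases rule: T.tensor_relations_cases)
    case (add_left r r' v)
    then show ?thesis
      by (simp add: \<chi>_def additive_ext_diff \<phi>_def kG_add sum.distrib distrib_right)
  next
    case (add_right r v v')
    then show ?thesis
      by (simp add: \<chi>_def additive_ext_diff \<phi>_def V distrib_left)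
  next
    case (balance r s v)
    have translate: "(\<Sum>x\<in>C. r (x \<otimes> inv z)) = (\<Sum>x\<in>C. r x)" if z: "z \<in> P" for z
    proof -
      obtain g where g: "g \<in> carrier G" "C = g <# P" using C by (auto simp: LCOSETS_def)
      have Cz: "x \<otimes> y \<in> C" if x: "x \<in> C" and y: "y \<in> P" for x y
      proof -
        obtain h where h: "h \<in> P" "x = g \<otimes> h" using x g(2) by (auto simp: l_coset_def)
        then have "x \<otimes> y = g \<otimes> (h \<otimes> y)" using g(1) PG y by (simp add: m_assoc)
        then show ?thesis using subgroup.m_closed[OF P h(1) y] g(2) by (auto simp: l_coset_def)
      qed
      have CG: "x \<in> carrier G" if "x \<in> C" for x using lcoset(1)[OF C] that by blast
      show ?thesis
        by (rule sum.reindex_bij_witness[where i = "\<lambda>x. x \<otimes> z" and j = "\<lambda>x. x \<otimes> inv z"])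
           (use z PG[OF z] CG Cz subgroup.m_inv_closed[OF P z] in \<open>auto simp: m_assoc\<close>)
    qed
    have "(\<Sum>x\<in>C. (r \<otimes>\<^bsub>kG\<^esub> s) x) = (\<Sum>x\<in>C. \<Sum>z\<in>carrier G. r (x \<otimes> inv z) * s z)"
      using lcoset(1)[OF C] by (intro sum.cong refl kG_mult_right) auto
    also have "\<dots> = (\<Sum>x\<in>C. \<Sum>z\<in>P. r (x \<otimes> inv z) * s z)"
      using balance(2) subgroup.subset[OF P]
      by (intro sum.cong refl sum.mono_neutral_right) (auto simp: SI)
    also have "\<dots> = (\<Sum>z\<in>P. (\<Sum>x\<in>C. r (x \<otimes> inv z)) * s z)"
      by (subst sum.swap) (simp add: sum_distrib_right)
    also have "\<dots> = (\<Sum>x\<in>C. r x) * (\<Sum>z\<in>P. s z)"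
      by (simp add: translate sum_distrib_left cong: sum.cong)
    finally show ?thesis using balance(4)
      by (simp add: \<chi>_def additive_ext_diff \<phi>_def V mult.assoc)
  qed
  have \<chi>_relators: "\<chi> C n = 0" if C: "C \<in> lcosets P" and n: "n \<in> T.relators" for C n
    using n unfolding T.relators_def
  proof (induction rule: generate.induct)
    case (inv h)
    then have "h \<in> carrier T.Free" using T.tensor_relations_subset by blast
    then have "inv\<^bsub>T.Free\<^esub> h = - h" by simp
    then show ?case using \<chi>_relation[OF C inv] by (simp add: \<chi>_def additive_ext_uminus)
  qed (auto simp: \<chi>_def additive_ext_add \<chi>_relation[OF C, unfolded \<chi>_def])
  have \<chi>_act: "\<chi> (g <# P) (T.act (group_element g) w) = \<chi> P w"
    if g: "g \<in> carrier G" and w: "w \<in> carrier T.Free" for g w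
  proof -
    have "\<phi> (g <# P) (group_element g \<otimes>\<^bsub>kG\<^esub> r, t) = \<phi> P (r, t)" for r t
    proof -
      have "(\<Sum>x\<in>g <# P. (group_element g \<otimes>\<^bsub>kG\<^esub> r) x) = (\<Sum>h\<in>P. (group_element g \<otimes>\<^bsub>kG\<^esub> r) (g \<otimes> h))"
      proof -
        have "g <# P = (\<lambda>h. g \<otimes> h) ` P" by (auto simp: l_coset_def)
        then show ?thesis
          using inj_on_g'[OF subgroup.subset[OF P] g] by (simp add: sum.reindex)
      qed
      also have "\<dots> = (\<Sum>h\<in>P. r h)"
        using g PG by (simp add: group_element_mult)
      finally show ?thesis by (simp add: \<phi>_def)
    qed
    then have "(\<lambda>i. \<phi> (g <# P) (case i of (r, v) \<Rightarrow> (group_element g \<otimes>\<^bsub>kG\<^esub> r, v))) = \<phi> P"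
      by auto
    moreover have "T.act (group_element g) w =
        frag_extend (\<lambda>i. frag_of (case i of (r, v) \<Rightarrow> (group_element g \<otimes>\<^bsub>kG\<^esub> r, v))) w"
      by (simp add: T.act_def case_prod_unfold)
    ultimately show ?thesis by (simp only: \<chi>_def additive_ext_frag_extend)
  qed
  have \<chi>_w0: "\<chi> C w0 = \<chi> P w0" if C: "C \<in> lcosets P" for C
  proof -
    obtain g where g: "g \<in> carrier G" "C = g <# P" using C by (auto simp: LCOSETS_def)
    have "T.tensor (T.act (group_element g) w0) = T.tensor w0"
      using m_fixed[OF g(1)] T.tensor_smult[OF group_element_closed[OF g(1)], of w0] w0(2) by simp
    then have "\<chi> C (T.act (group_element g) w0 - w0) = 0"
      using \<chi>_relators[OF C] by (simp add: T.tensor_eq_iff)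
    then show ?thesis using \<chi>_act[OF g(1) w0(1)] g(2) by (simp add: \<chi>_def additive_ext_diff)
  qed
  have \<chi>_G: "\<chi> (carrier G) w = (\<Sum>C\<in>lcosets P. \<chi> C w)" for w
  proof -
    have "(\<Sum>x\<in>carrier G. r x) = (\<Sum>C\<in>lcosets P. \<Sum>x\<in>C. r x)" for r :: "'g \<Rightarrow> 'k"
    proof -
      have "sum r (\<Union>(lcosets P)) = (\<Sum>C\<in>lcosets P. \<Sum>x\<in>C. r x)"
        using sum.Union_disjoint[of "lcosets P" r] lcoset lcos_disjoint[OF P] by auto
      then show ?thesis by (simp add: lcosets_part_G[OF P])
    qed
    then have "\<phi> (carrier G) = (\<lambda>i. \<Sum>C\<in>lcosets P. \<phi> C i)"
      by (auto simp: \<phi>_def sum_distrib_right)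
    then show ?thesis by (simp add: \<chi>_def additive_ext_sum)
  qed
  define l where "l = \<pi> (T.tensor (frag_of (\<one>\<^bsub>kG\<^esub>, 1)))"
  have \<pi>_eq: "Poly_Mapping.keys w \<subseteq> carrier kG \<times> carrier ?V \<and> \<pi> (T.tensor w) = l * \<chi> (carrier G) w"
    if "w \<in> carrier T.Free" for w
  proof -
    have mem: "T.tensor 0 \<in> carrier T.E" by (simp add: T.carrier_E)
    have "\<pi> (T.tensor 0) = \<pi> (T.tensor 0) + \<pi> (T.tensor 0)"
      using \<pi>_add[OF mem mem] unfolding T.tensor_add[of 0 0, simplified] .
    then have zero: "\<pi> (T.tensor 0) = 0" by (metis add_cancel_right_right)
    from that have "Poly_Mapping.keys w \<subseteq> carrier kG \<times> carrier ?V" by simp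
    then show ?thesis
    proof (induction w rule: frag_induction)
      case zero
      show ?case using \<open>\<pi> (T.tensor 0) = 0\<close> by (simp add: \<chi>_def)
    next
      case (one i)
      obtain r t where i: "i = (r, t)" "r \<in> carrier kG" using one by auto
      \<comment> \<open>\<open>s\<close> is \<open>t\<close> as a scalar multiple of the identity: \<open>r \<otimes> t = r s \<otimes> 1 = (r s) (1 \<otimes> 1)\<close>.\<close>
      define s where "s = (\<lambda>x. if x = \<one> then t else 0)"
      have s: "s \<in> carrier ?S" using subgroup.one_closed[OF P] by (auto simp: SI s_def)
      have sum_s: "(\<Sum>x\<in>P. s x) = t" using finP subgroup.one_closed[OF P] by (simp add: s_def)
      have "T.tensor (frag_of (r, t)) = T.tensor (frag_of (r \<otimes>\<^bsub>kG\<^esub> s, 1))"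
        using T.tensor_balanced[OF i(2) s, of 1] by (simp add: V sum_s)
      also have "\<dots> = (r \<otimes>\<^bsub>kG\<^esub> s) \<odot>\<^bsub>T.E\<^esub> T.tensor (frag_of (\<one>\<^bsub>kG\<^esub>, 1))"
        using T.tensor_smult[OF kG_mult_closed] by (simp add: T.act_of kG_mult_closed)
      finally have "\<pi> (T.tensor (frag_of (r, t))) = (\<Sum>g\<in>carrier G. (r \<otimes>\<^bsub>kG\<^esub> s) g) * l"
        using \<pi>_smult[OF kG_mult_closed, of "T.tensor (frag_of (\<one>\<^bsub>kG\<^esub>, 1))" r s]
        by (simp add: l_def T.carrier_E V)
      also have "r \<otimes>\<^bsub>kG\<^esub> s = (\<lambda>x. r x * t)"
      proof
        fix x show "(r \<otimes>\<^bsub>kG\<^esub> s) x = r x * t"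
        proof (cases "x \<in> carrier G")
          case True
          then show ?thesis
            by (simp add: kG_mult_right s_def if_distrib[of "\<lambda>u. _ * u"] cong: if_cong)
        qed (use kG_outside[OF i(2)] in \<open>simp add: kG_mult\<close>)
      qed
      finally have "\<pi> (T.tensor (frag_of i)) = l * ((\<Sum>g\<in>carrier G. r g) * t)"
        unfolding i sum_distrib_right[symmetric] by (simp only: mult.commute)
      moreover have "\<chi> (carrier G) (frag_of i) = (\<Sum>g\<in>carrier G. r g) * t"
        by (simp add: \<chi>_def \<phi>_def i)
      ultimately show ?case using i by (simp add: V(1))
    next
      case (diff w w')
      then have w: "w \<in> carrier T.Free" "w' \<in> carrier T.Free" "w - w' \<in> carrier T.Free"
        using keys_diff[of w w'] by auto
      have "\<pi> (T.tensor ((w - w') + w')) = \<pi> (T.tensor (w - w')) + \<pi> (T.tensor w')"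
        using \<pi>_add[of "T.tensor (w - w')" "T.tensor w'"] w(2,3)
        unfolding T.tensor_add[OF w(3,2)] T.carrier_E by blast
      then show ?case using diff w(3) by (simp add: \<chi>_def additive_ext_diff algebra_simps)
    qed
  qed
  have "\<pi> m = l * (\<Sum>C\<in>lcosets P. \<chi> P w0)"
    using \<pi>_eq[OF w0(1)] w0(2) by (simp add: \<chi>_G \<chi>_w0 cong: sum.cong)
  then have "\<pi> m = of_nat (card (lcosets P)) * (l * \<chi> P w0)" by (simp add: mult_ac)
  then show ?thesis using \<pi>m by auto
qed

text \<open>The trivial source of the Scott module makes the trivial module a retract of the module induced
  from the trivial module of \<open>P\<close>. The image of \<open>1\<close> in the induced module is a \<open>G\<close>-fixed element on which the retraction does not
  vanish.\<close>
lemma index_nonzero_if_Scott_module_trivial: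
  assumes Scott: "is_Scott_module G P (L :: ('g \<Rightarrow> 'k, 's) module)"
    and triv: "module_isomorphic kG L (trivial_module G)"
  shows "of_nat (card (lcosets P)) \<noteq> (0 :: 'k)"
proof -
  define M where "M = induced_module G P (trivial_module (G\<lparr>carrier := P\<rparr>) :: ('g \<Rightarrow> 'k, 'k) module)"
  have P: "subgroup P G" and L: "left_module kG L" and summand: "isomorphic_to_summand kG L M"
    using Scott by (auto simp: is_Scott_module_def is_source_def is_vertex_def fin_gen_module_def M_def)
  interpret L: left_module kG L by fact
  interpret T: scalar_extension kG "subgroup_algebra G P :: ('k, 'g \<Rightarrow> 'k) module"
    "trivial_module (G\<lparr>carrier := P\<rparr>) :: ('g \<Rightarrow> 'k, 'k) module"
    by (rule trivial_scalar_extension[OF P])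
  have ME: "M = T.E" by (simp add: M_def induced_module_def)
  obtain \<iota> \<rho> where \<iota>: "\<iota> \<in> carrier L \<rightarrow> carrier M" and \<rho>: "\<rho> \<in> carrier M \<rightarrow> carrier L"
    and retract: "\<And>s. s \<in> carrier L \<Longrightarrow> \<rho> (\<iota> s) = s"
    and \<iota>_smult: "\<And>a s. \<lbrakk>a \<in> carrier kG; s \<in> carrier L\<rbrakk> \<Longrightarrow> \<iota> (a \<odot>\<^bsub>L\<^esub> s) = a \<odot>\<^bsub>M\<^esub> \<iota> s"
    and \<rho>_add: "\<And>x y. \<lbrakk>x \<in> carrier M; y \<in> carrier M\<rbrakk> \<Longrightarrow> \<rho> (x \<oplus>\<^bsub>M\<^esub> y) = \<rho> x \<oplus>\<^bsub>L\<^esub> \<rho> y"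
    and \<rho>_smult: "\<And>a x. \<lbrakk>a \<in> carrier kG; x \<in> carrier M\<rbrakk> \<Longrightarrow> \<rho> (a \<odot>\<^bsub>M\<^esub> x) = a \<odot>\<^bsub>L\<^esub> \<rho> x"
    using summand_retraction[OF T.abelian_group_E T.smult_add_E L summand[unfolded ME]]
    unfolding ME by blast
  obtain h where h: "h \<in> iso (add_monoid L) (add_monoid (trivial_module G :: ('g \<Rightarrow> 'k, 'k) module))"
    and h_smult: "\<And>a x. \<lbrakk>a \<in> carrier kG; x \<in> carrier L\<rbrakk> \<Longrightarrow> h (a \<odot>\<^bsub>L\<^esub> x) = (\<Sum>g\<in>carrier G. a g) * h x"
    using triv by (auto simp: module_isomorphic_def trivial_module_def)
  have h_add: "h (x \<oplus>\<^bsub>L\<^esub> y) = h x + h y" if "x \<in> carrier L" "y \<in> carrier L" for x y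
    using h that by (auto simp: iso_def hom_def trivial_module_def)
  have h_bij: "bij_betw h (carrier L) UNIV"
    using h by (simp add: iso_def trivial_module_def)
  obtain s where s: "s \<in> carrier L" "h s = 1"
    using h_bij unfolding bij_betw_def by (metis UNIV_I imageE)
  show ?thesis
  proof (rule index_nonzero_if_trivial_summand[OF P M_def, where m = "\<iota> s" and \<pi> = "\<lambda>x. h (\<rho> x)"])
    show "\<iota> s \<in> carrier M" using \<iota> s by blast
    show "h (\<rho> (x \<oplus>\<^bsub>M\<^esub> y)) = h (\<rho> x) + h (\<rho> y)" if "x \<in> carrier M" "y \<in> carrier M" for x y
      using \<rho>_add[OF that] h_add \<rho> that by (simp add: Pi_iff)
    show "h (\<rho> (a \<odot>\<^bsub>M\<^esub> x)) = (\<Sum>g\<in>carrier G. a g) * h (\<rho> x)"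
      if "a \<in> carrier kG" "x \<in> carrier M" for a x
      using \<rho>_smult[OF that] h_smult \<rho> that by (simp add: Pi_iff)
    show "group_element g \<odot>\<^bsub>M\<^esub> \<iota> s = \<iota> s" if g: "g \<in> carrier G" for g
    proof -
      note ge = group_element_closed[OF g]
      have gs: "group_element g \<odot>\<^bsub>L\<^esub> s \<in> carrier L" by (rule L.smult_closed[OF ge s(1)])
      have "(\<Sum>x\<in>carrier G. group_element g x :: 'k) = 1"
        using g by (simp add: group_element_def)
      then have "h (group_element g \<odot>\<^bsub>L\<^esub> s) = h s" using h_smult[OF ge s(1)] by simp
      then have "group_element g \<odot>\<^bsub>L\<^esub> s = s"
        using h_bij gs s(1) unfolding bij_betw_def by (meson inj_onD)
      then show ?thesis using \<iota>_smult[OF ge s(1)] by simp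
    qed
    show "h (\<rho> (\<iota> s)) \<noteq> 0" using s retract by simp
  qed
qed

end

section \<open>Derivations of a block from additive homomorphisms\<close>

text \<open>Only what makes \<open>0\<close> an inner derivation and neutral for addition is assumed about \<open>A\<close>: then \<open>D\<close> lies in its own coset modulo the inner derivations, and that coset is the zero coset.\<close>
lemma derivation_inner_if_HH1_trivial:
  fixes A :: "('k::field, 'a, 'm) module_scheme"
  assumes trivial: "carrier (HH1 A) = {\<zero>\<^bsub>HH1 A\<^esub>}"
    and zero: "\<zero>\<^bsub>A\<^esub> \<in> carrier A"
    and zero_add: "\<And>x. x \<in> carrier A \<Longrightarrow> \<zero>\<^bsub>A\<^esub> \<oplus>\<^bsub>A\<^esub> x = x"
    and zero_commutator: "\<And>x. x \<in> carrier A \<Longrightarrow> \<zero>\<^bsub>A\<^esub> \<otimes>\<^bsub>A\<^esub> x \<ominus>\<^bsub>A\<^esub> x \<otimes>\<^bsub>A\<^esub> \<zero>\<^bsub>A\<^esub> = \<zero>\<^bsub>A\<^esub>"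
    and D: "D \<in> derivations A"
  shows "D \<in> inner_derivations A"
proof -
  let ?I = "inner_derivations A" and ?DS = "derivation_space A"
  have "?I +>\<^bsub>?DS\<^esub> D \<in> carrier (HH1 A)"
    using D by (auto simp: HH1_def quotient_module_def A_RCOSETS_def RCOSETS_def a_r_coset_def derivation_space_def)
  then have coset: "?I +>\<^bsub>?DS\<^esub> D = ?I" using trivial by (simp add: HH1_def quotient_module_def)
  have "(\<lambda>x\<in>carrier A. \<zero>\<^bsub>A\<^esub> \<otimes>\<^bsub>A\<^esub> x \<ominus>\<^bsub>A\<^esub> x \<otimes>\<^bsub>A\<^esub> \<zero>\<^bsub>A\<^esub>) \<in> ?I"
    unfolding inner_derivations_def using zero by blast
  moreover have "(\<lambda>x\<in>carrier A. \<zero>\<^bsub>A\<^esub> \<otimes>\<^bsub>A\<^esub> x \<ominus>\<^bsub>A\<^esub> x \<otimes>\<^bsub>A\<^esub> \<zero>\<^bsub>A\<^esub>) = (\<lambda>x\<in>carrier A. \<zero>\<^bsub>A\<^esub>)"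
    using zero_commutator by (intro restrict_ext)
  ultimately have zero_inner: "(\<lambda>x\<in>carrier A. \<zero>\<^bsub>A\<^esub>) \<in> ?I" by simp
  have D_ext: "D \<in> carrier A \<rightarrow>\<^sub>E carrier A" using D by (simp add: derivations_def)
  have "(\<lambda>x\<in>carrier A. (\<lambda>x\<in>carrier A. \<zero>\<^bsub>A\<^esub>) x \<oplus>\<^bsub>A\<^esub> D x) = D"
  proof
    fix x show "(\<lambda>x\<in>carrier A. (\<lambda>x\<in>carrier A. \<zero>\<^bsub>A\<^esub>) x \<oplus>\<^bsub>A\<^esub> D x) x = D x"
      using zero_add PiE_mem[OF D_ext] PiE_arb[OF D_ext] by (cases "x \<in> carrier A") auto
  qed
  then have "D = (\<lambda>x\<in>carrier A. \<zero>\<^bsub>A\<^esub>) \<oplus>\<^bsub>?DS\<^esub> D"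
    by (simp add: derivation_space_def)
  then have "D \<in> ?I +>\<^bsub>?DS\<^esub> D"
    using zero_inner by (auto simp: a_r_coset_def r_coset_def)
  then show ?thesis using coset by simp
qed

context finite_group_algebra
begin

text \<open>For an additive homomorphism \<open>f\<close> this is the derivation of the group algebra with \<open>g \<mapsto> f(g) g\<close>.\<close>
abbreviation weight :: "('g \<Rightarrow> 'k) \<Rightarrow> ('g \<Rightarrow> 'k) \<Rightarrow> 'g \<Rightarrow> 'k" where
  "weight f x \<equiv> (\<lambda>g. f g * x g)"

lemma weight_mult:
  assumes f: "\<And>x y. \<lbrakk>x \<in> carrier G; y \<in> carrier G\<rbrakk> \<Longrightarrow> f (x \<otimes> y) = f x + f y"
  shows "weight f (x \<otimes>\<^bsub>kG\<^esub> y) = weight f x \<otimes>\<^bsub>kG\<^esub> y \<oplus>\<^bsub>kG\<^esub> x \<otimes>\<^bsub>kG\<^esub> weight f y"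
proof
  fix g
  show "weight f (x \<otimes>\<^bsub>kG\<^esub> y) g = (weight f x \<otimes>\<^bsub>kG\<^esub> y \<oplus>\<^bsub>kG\<^esub> x \<otimes>\<^bsub>kG\<^esub> weight f y) g"
  proof (cases "g \<in> carrier G")
    case True
    have fg: "f g = f h + f (inv h \<otimes> g)" if "h \<in> carrier G" for h
      using f[of h "inv h \<otimes> g"] that True by (simp add: m_assoc[symmetric])
    have "f g * (x h * y (inv h \<otimes> g)) =
        f h * x h * y (inv h \<otimes> g) + x h * (f (inv h \<otimes> g) * y (inv h \<otimes> g))"
      if "h \<in> carrier G" for h
      unfolding fg[OF that] by (simp add: algebra_simps)
    then show ?thesis
      using True by (simp add: kG_mult kG_add sum_distrib_left sum.distrib cong: sum.cong)
  qed (simp add: kG_mult kG_add)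
qed

text \<open>A derivation maps \<open>b = b\<^sup>2\<close> to \<open>c = c b + b c = 2 c b\<close>. Multiplication by \<open>b\<close> gives
  \<open>c b = 2 c b\<close>, so \<open>c b = 0\<close> and \<open>c = 0\<close>.\<close>
lemma weight_central_idempotent:
  assumes f: "\<And>x y. \<lbrakk>x \<in> carrier G; y \<in> carrier G\<rbrakk> \<Longrightarrow> f (x \<otimes> y) = f x + f y"
    and bZ: "b \<in> ring_center kG" and bb: "b \<otimes>\<^bsub>kG\<^esub> b = b"
  shows "weight f b = \<zero>\<^bsub>kG\<^esub>"
proof -
  define c where "c = weight f b"
  have b: "b \<in> carrier kG" using bZ by (simp add: ring_center_iff)
  have c: "c \<in> carrier kG" using kG_outside[OF b] by (simp add: c_def kG_carrier_iff)
  have cb: "c \<otimes>\<^bsub>kG\<^esub> b = b \<otimes>\<^bsub>kG\<^esub> c" using bZ c by (auto simp: ring_center_def)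
  have c_eq: "c = c \<otimes>\<^bsub>kG\<^esub> b \<oplus>\<^bsub>kG\<^esub> c \<otimes>\<^bsub>kG\<^esub> b"
    using weight_mult[OF f, of b b] unfolding bb c_def[symmetric] cb .
  have "c \<otimes>\<^bsub>kG\<^esub> b = (c \<otimes>\<^bsub>kG\<^esub> b \<oplus>\<^bsub>kG\<^esub> c \<otimes>\<^bsub>kG\<^esub> b) \<otimes>\<^bsub>kG\<^esub> b" using c_eq by simp
  also have "\<dots> = c \<otimes>\<^bsub>kG\<^esub> b \<oplus>\<^bsub>kG\<^esub> c \<otimes>\<^bsub>kG\<^esub> b"
    using b c bb by (simp add: kG.l_distr kG.m_assoc)
  finally have "c \<otimes>\<^bsub>kG\<^esub> b = c" using c_eq by simp
  then have "c = c \<oplus>\<^bsub>kG\<^esub> c" using c_eq by simp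
  then have "c g = c g + c g" for g unfolding kG_add by (rule fun_cong)
  then have "c g = 0" for g by (metis add_cancel_right_right)
  then show ?thesis unfolding c_def[symmetric] kG_zero by (rule ext)
qed

lemma block_algebra_simps:
  "\<zero>\<^bsub>block_algebra G b\<^esub> = \<zero>\<^bsub>kG\<^esub>" "x \<oplus>\<^bsub>block_algebra G b\<^esub> y = x \<oplus>\<^bsub>kG\<^esub> y"
  "x \<otimes>\<^bsub>block_algebra G b\<^esub> y = x \<otimes>\<^bsub>kG\<^esub> y" "t \<odot>\<^bsub>block_algebra G b\<^esub> x = t \<odot>\<^bsub>kG\<^esub> x"
  by (simp_all add: block_algebra_def)

lemma block_algebra_carrier_iff:
  assumes b: "b \<in> carrier kG" and bb: "b \<otimes>\<^bsub>kG\<^esub> b = b"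
  shows "x \<in> carrier (block_algebra G b) \<longleftrightarrow> x \<in> carrier kG \<and> x \<otimes>\<^bsub>kG\<^esub> b = x"
proof
  assume "x \<in> carrier (block_algebra G b)"
  then obtain a where "a \<in> carrier kG" "x = a \<otimes>\<^bsub>kG\<^esub> b" by (auto simp: block_algebra_def)
  then show "x \<in> carrier kG \<and> x \<otimes>\<^bsub>kG\<^esub> b = x" using b bb by (simp add: kG.m_assoc)
next
  assume x: "x \<in> carrier kG \<and> x \<otimes>\<^bsub>kG\<^esub> b = x"
  then have "\<exists>a. x = a \<otimes>\<^bsub>kG\<^esub> b \<and> a \<in> carrier kG" by metis
  then show "x \<in> carrier (block_algebra G b)" by (simp add: block_algebra_def)
qed

lemma block_algebra_minus:
  assumes b: "b \<in> carrier kG" and bb: "b \<otimes>\<^bsub>kG\<^esub> b = b"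
    and y: "y \<in> carrier (block_algebra G b)"
  shows "x \<ominus>\<^bsub>block_algebra G b\<^esub> y = (\<lambda>g. x g - y g)"
proof -
  have yG: "y \<in> carrier kG" and yb: "y \<otimes>\<^bsub>kG\<^esub> b = y" using y by (simp_all add: block_algebra_carrier_iff[OF b bb])
  have neg: "(\<lambda>g. - y g) = \<ominus>\<^bsub>kG\<^esub> y" using kG_uminus[OF yG] ..
  have "(\<lambda>g. - y g) \<in> carrier (block_algebra G b)"
    unfolding block_algebra_carrier_iff[OF b bb] neg using yG yb b by (simp add: kG.l_minus)
  then have "\<ominus>\<^bsub>block_algebra G b\<^esub> y = (\<lambda>g. - y g)"
    unfolding a_inv_def m_inv_def
    by (intro the_equality) (auto simp: block_algebra_simps kG_add kG_zero fun_eq_iff eq_neg_iff_add_eq_0 add.commute)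
  then show ?thesis by (simp add: a_minus_def block_algebra_simps kG_add)
qed

text \<open>Since the derivation kills \<open>b\<close>, the image of \<open>x = x b\<close> is again a multiple of \<open>b\<close>.\<close>
lemma weight_block_derivation:
  assumes f: "\<And>x y. \<lbrakk>x \<in> carrier G; y \<in> carrier G\<rbrakk> \<Longrightarrow> f (x \<otimes> y) = f x + f y"
    and bZ: "b \<in> ring_center kG" and bb: "b \<otimes>\<^bsub>kG\<^esub> b = b"
  shows "(\<lambda>x\<in>carrier (block_algebra G b). weight f x) \<in> derivations (block_algebra G b)"
proof -
  have b: "b \<in> carrier kG" using bZ by (simp add: ring_center_iff)
  note B = block_algebra_carrier_iff[OF b bb]
  have wG: "weight f x \<in> carrier kG" if "x \<in> carrier kG" for x
    using kG_outside[OF that] by (simp add: kG_carrier_iff)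
  have wB: "weight f x \<in> carrier (block_algebra G b)" if "x \<in> carrier (block_algebra G b)" for x
  proof -
    have x: "x \<in> carrier kG" "x \<otimes>\<^bsub>kG\<^esub> b = x" using that by (auto simp: B)
    have "weight f x = weight f x \<otimes>\<^bsub>kG\<^esub> b"
      using weight_mult[OF f, of x b] x wG[OF x(1)] b
      by (simp add: weight_central_idempotent[OF f bZ bb])
    then show ?thesis using wG[OF x(1)] by (simp add: B)
  qed
  have add: "x \<oplus>\<^bsub>kG\<^esub> y \<in> carrier (block_algebra G b)"
    and mult: "x \<otimes>\<^bsub>kG\<^esub> y \<in> carrier (block_algebra G b)"
    if "x \<in> carrier (block_algebra G b)" "y \<in> carrier (block_algebra G b)" for x y
    using that b by (simp_all add: B kG.l_distr kG.m_assoc)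
  have smult: "t \<odot>\<^bsub>kG\<^esub> x \<in> carrier (block_algebra G b)" if "x \<in> carrier (block_algebra G b)" for t x
  proof -
    have x: "x \<in> carrier kG" "x \<otimes>\<^bsub>kG\<^esub> b = x" using that by (auto simp: B)
    have "(t \<odot>\<^bsub>kG\<^esub> x) \<otimes>\<^bsub>kG\<^esub> b = t \<odot>\<^bsub>kG\<^esub> (x \<otimes>\<^bsub>kG\<^esub> b)"
      by (simp add: kG_mult kG_smult fun_eq_iff sum_distrib_left mult.assoc)
    then show ?thesis using x kG_outside[OF x(1)] by (simp add: B kG_smult kG_carrier_iff)
  qed
  have wadd: "weight f (x \<oplus>\<^bsub>kG\<^esub> y) = weight f x \<oplus>\<^bsub>kG\<^esub> weight f y" for x y
    by (simp add: kG_add distrib_left)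
  have wsmult: "weight f (t \<odot>\<^bsub>kG\<^esub> x) = t \<odot>\<^bsub>kG\<^esub> weight f x" for t x
    by (simp add: kG_smult mult_ac)
  show ?thesis
    unfolding derivations_def block_algebra_simps
    by (intro CollectI conjI ballI allI)
       (simp_all add: wB add mult smult wadd wsmult weight_mult[OF f])
qed

text \<open>Compare the coefficients at \<open>h g\<close> of the two expressions for the image of \<open>h b\<close>. The
  commutator of \<open>c\<close> and \<open>h b\<close> is that of \<open>c\<close> and \<open>h\<close>, whose coefficient at \<open>h g\<close> is
  \<open>c(h g h\<inverse>) - c(g) = 0\<close>. On the other side stands \<open>f(h g) b(g) = (f(h) + f(g)) b(g)\<close>, and \<open>f(g) b(g) = 0\<close>
  because the derivation kills \<open>b\<close>.\<close>
lemma inner_weight_vanishes: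
  assumes f: "\<And>x y. \<lbrakk>x \<in> carrier G; y \<in> carrier G\<rbrakk> \<Longrightarrow> f (x \<otimes> y) = f x + f y"
    and bZ: "b \<in> ring_center kG" and bb: "b \<otimes>\<^bsub>kG\<^esub> b = b"
    and inner: "(\<lambda>x\<in>carrier (block_algebra G b). weight f x) \<in> inner_derivations (block_algebra G b)"
    and g: "g \<in> carrier G" "b g \<noteq> 0" and h: "h \<in> carrier G" "h \<otimes> g = g \<otimes> h"
  shows "f h = 0"
proof -
  have b: "b \<in> carrier kG" using bZ by (simp add: ring_center_iff)
  note B = block_algebra_carrier_iff[OF b bb]
  obtain c where c: "c \<in> carrier (block_algebra G b)"
    and eq: "(\<lambda>x\<in>carrier (block_algebra G b). weight f x) =
      (\<lambda>x\<in>carrier (block_algebra G b). c \<otimes>\<^bsub>kG\<^esub> x \<ominus>\<^bsub>block_algebra G b\<^esub> x \<otimes>\<^bsub>kG\<^esub> c)"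
    using inner by (auto simp: inner_derivations_def block_algebra_simps)
  have cG: "c \<in> carrier kG" and cb: "c \<otimes>\<^bsub>kG\<^esub> b = c" using c by (auto simp: B)
  have bc: "b \<otimes>\<^bsub>kG\<^esub> c = c" using bZ cG cb by (auto simp: ring_center_def)
  let ?h = "group_element h :: 'g \<Rightarrow> 'k"
  have hG: "?h \<in> carrier kG" by (rule group_element_closed[OF h(1)])
  define x where "x = ?h \<otimes>\<^bsub>kG\<^esub> b"
  have x: "x \<in> carrier (block_algebra G b)" using hG b bb by (simp add: x_def B kG.m_assoc)
  have xc: "x \<otimes>\<^bsub>kG\<^esub> c = ?h \<otimes>\<^bsub>kG\<^esub> c" using hG b cG bc by (simp add: x_def kG.m_assoc)
  have "x = b \<otimes>\<^bsub>kG\<^esub> ?h" using bZ hG by (auto simp: x_def ring_center_def)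
  then have cx: "c \<otimes>\<^bsub>kG\<^esub> x = c \<otimes>\<^bsub>kG\<^esub> ?h" using hG b cG cb by (simp add: kG.m_assoc[symmetric])
  have "x \<otimes>\<^bsub>kG\<^esub> c \<in> carrier (block_algebra G b)"
    using x cG cb b by (simp add: B kG.m_assoc)
  then have "weight f x = (\<lambda>y. (c \<otimes>\<^bsub>kG\<^esub> x) y - (x \<otimes>\<^bsub>kG\<^esub> c) y)"
    using fun_cong[OF eq, of x] x block_algebra_minus[OF b bb] by simp
  then have "f (h \<otimes> g) * x (h \<otimes> g) = (c \<otimes>\<^bsub>kG\<^esub> ?h) (h \<otimes> g) - (?h \<otimes>\<^bsub>kG\<^esub> c) (h \<otimes> g)"
    unfolding cx xc by (rule fun_cong)
  also have "(c \<otimes>\<^bsub>kG\<^esub> ?h) (h \<otimes> g) = c g"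
    using g(1) h(1) unfolding h(2) by (simp add: mult_group_element m_assoc)
  also have "(?h \<otimes>\<^bsub>kG\<^esub> c) (h \<otimes> g) = c g"
    using g(1) h(1) by (simp add: group_element_mult)
  also have "x (h \<otimes> g) = b g"
    using g(1) h(1) by (simp add: x_def group_element_mult)
  finally have "f (h \<otimes> g) * b g = 0" by simp
  moreover have "f g * b g = 0"
    using fun_cong[OF weight_central_idempotent[OF f bZ bb], of g] by (simp add: kG_zero)
  ultimately show ?thesis using f[OF h(1) g(1)] g(2) by simp
qed

text \<open>Left translation by \<open>x\<close> preserves the sum of \<open>f\<close> over the left cosets of \<open>P\<close> and increases each term by \<open>f x\<close>.\<close>
lemma additive_hom_zero_if_zero_on_subgroup:
  assumes f: "\<And>x y. \<lbrakk>x \<in> carrier G; y \<in> carrier G\<rbrakk> \<Longrightarrow> f (x \<otimes> y) = (f x + f y :: 'k)"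
    and P: "subgroup P G" and fP: "\<And>h. h \<in> P \<Longrightarrow> f h = 0"
    and index: "of_nat (card (lcosets P)) \<noteq> (0 :: 'k)" and x: "x \<in> carrier G"
  shows "f x = 0"
proof -
  have f_cong: "f g = f h" if "g \<in> carrier G" "h \<in> carrier G" "g <# P = h <# P" for g h
    using f[of g "inv g \<otimes> h"] fP that by (simp add: lcos_eq_iff[OF P])
  have "(\<Sum>C\<in>lcosets P. f (x \<otimes> coset_rep C)) = (\<Sum>C\<in>lcosets P. f (coset_rep C))"
    by (rule sum_lcosets_translate[OF P x f_cong])
  moreover have "(\<Sum>C\<in>lcosets P. f (x \<otimes> coset_rep C)) =
      of_nat (card (lcosets P)) * f x + (\<Sum>C\<in>lcosets P. f (coset_rep C))"
    using f[OF x] coset_rep(1)[OF P] by (simp add: sum.distrib)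
  ultimately show ?thesis using index by simp
qed

end

section \<open>First Hochschild cohomology of a block with trivial Scott module\<close>

theorem theorem1p5:
  fixes G :: "('g, 'z) monoid_scheme"
    and p :: nat
    and b :: "'g \<Rightarrow> 'k::alg_closed_field"
    and P :: "'g set"
    and S :: "('g \<Rightarrow> 'k, 's) module"
  assumes "prime p" and "CHAR('k) = p"
    and "group G" and "finite (carrier G)"
    and "block_idempotent G b"
    and "defect_group G b P" and "P \<noteq> {\<one>\<^bsub>G\<^esub>}"
    and "non_p_perfect p G"
    and "is_Scott_module G P S"
    and "module_isomorphic (group_algebra G) S (trivial_module G)"
  shows "carrier (HH1 (block_algebra G b)) \<noteq> {\<zero>\<^bsub>HH1 (block_algebra G b)\<^esub>}"
proof
  assume trivial: "carrier (HH1 (block_algebra G b)) = {\<zero>\<^bsub>HH1 (block_algebra G b)\<^esub>}"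
  interpret finite_group_algebra G "TYPE('k)"
    using assms(3,4) by (simp add: finite_group_algebra_def finite_group_algebra_axioms_def)
  let ?B = "block_algebra G b"
  have P: "subgroup P G" using assms(6) by (simp add: defect_group_def)
  have bZ: "b \<in> ring_center kG" and bb: "b \<otimes>\<^bsub>kG\<^esub> b = b"
    using assms(5) by (simp_all add: block_idempotent_def primitive_idempotent_def)
  have b: "b \<in> carrier kG" using bZ by (simp add: ring_center_iff)
  obtain f :: "'g \<Rightarrow> 'k" and x where
    f: "\<And>x y. \<lbrakk>x \<in> carrier G; y \<in> carrier G\<rbrakk> \<Longrightarrow> f (x \<otimes>\<^bsub>G\<^esub> y) = f x + f y"
    and x: "x \<in> carrier G" "f x \<noteq> 0"
    using exists_nonzero_additive_hom[OF assms(4,2,1,8)] by blast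
  obtain g where g: "g \<in> carrier G" "b g \<noteq> 0"
    and comm: "\<And>h. h \<in> P \<Longrightarrow> h \<otimes>\<^bsub>G\<^esub> g = g \<otimes>\<^bsub>G\<^esub> h"
    using defect_group_meets_centralizer[OF assms(5,6)] by blast
  have "(\<lambda>x\<in>carrier ?B. weight f x) \<in> inner_derivations ?B"
  proof (rule derivation_inner_if_HH1_trivial[OF trivial])
    show zero: "\<zero>\<^bsub>?B\<^esub> \<in> carrier ?B"
      using b by (simp add: block_algebra_simps block_algebra_carrier_iff[OF b bb])
    show "\<zero>\<^bsub>?B\<^esub> \<oplus>\<^bsub>?B\<^esub> y = y" if "y \<in> carrier ?B" for y
      by (simp add: block_algebra_simps kG_add kG_zero)
    show "\<zero>\<^bsub>?B\<^esub> \<otimes>\<^bsub>?B\<^esub> y \<ominus>\<^bsub>?B\<^esub> y \<otimes>\<^bsub>?B\<^esub> \<zero>\<^bsub>?B\<^esub> = \<zero>\<^bsub>?B\<^esub>" if "y \<in> carrier ?B" for y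
      using that zero block_algebra_minus[OF b bb zero, of "\<zero>\<^bsub>?B\<^esub>"]
      by (simp add: block_algebra_simps block_algebra_carrier_iff[OF b bb]) (simp add: kG_zero)
  qed (rule weight_block_derivation[OF f bZ bb])
  then have "f h = 0" if "h \<in> P" for h
    using inner_weight_vanishes[OF f bZ bb _ g _ comm[OF that]] subgroup.mem_carrier[OF P that] by blast
  then have "f x = 0"
    using additive_hom_zero_if_zero_on_subgroup[OF f P _ index_nonzero_if_Scott_module_trivial[OF assms(9,10)] x(1)]
    by blast
  then show False using x(2) by simp
qed

end
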